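(* For any $p,k,m\in\mathbb{N}$, $$\sum_{n=p-1}^\infty\left[\frac{1}{4^n}\binom{2n}{n}\right]^2\frac{t_n(2_{p-1})}{(2n+1)^m}\in\frac{i}{\pi}\mathrm{CMZV}^4_{2p+m-1},\qquad\sum_{n=p}^\infty\left[\frac{4^n}{\binom{2n}{n}}\right]^2\frac{\zeta_{n-1}(2_{p-1})t^\star_n(1_k)}{n^{m+2}}\in\mathrm{CMZV}^4_{2p+k+m}.$$
   Context: $i=\sqrt{-1}$. $\zeta_n(\mathbf{a})=\sum_{n\ge n_1>\cdots>n_s>0}\prod_j n_j^{-a_j}$, $t_n(\mathbf{a})=\sum_{n\ge n_1>\cdots>n_s>0}\prod_j(2n_j-1)^{-a_j}$, $t^\star_n(\mathbf{a})=\sum_{n\ge n_1\ge\cdots\ge n_s>0}\prod_j(2n_j-1)^{-a_j}$, each $1$ on the empty composition; $2_d$ (resp. $1_d$) is the string of $d$ twos (resp. ones). $\mathrm{CMZV}^4_w$ is the $\mathbb{Q}$-span of colored multiple zeta values $\sum_{n_1>\cdots>n_s>0}\prod_j z_j^{n_j}n_j^{-a_j}$ of weight $w$ with all $z_j$ fourth roots of unity and $(a_1,z_1)\ne(1,1)$; $\frac{i}{\pi}\mathrm{CMZV}^4_w=\{\frac{i}{\pi}x:x\in\mathrm{CMZV}^4_w\}$. *)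

theory Defs
  imports "HOL-Analysis.Analysis"
begin

text \<open>
  Summation indices are lists \<open>[n\<^sub>1, \<dots>, n\<^sub>s]\<close>; compositions \<open>(a\<^sub>1, \<dots>, a\<^sub>s)\<close> are lists
  of natural numbers, so that \<open>replicate d 2\<close> is the string of \<open>d\<close> twos.
\<close>

definition strict_indices :: "nat \<Rightarrow> nat \<Rightarrow> nat list set" where
  "strict_indices n s = {ns. length ns = s \<and> set ns \<subseteq> {1..n} \<and> sorted_wrt (>) ns}"

definition weak_indices :: "nat \<Rightarrow> nat \<Rightarrow> nat list set" where
  "weak_indices n s = {ns. length ns = s \<and> set ns \<subseteq> {1..n} \<and> sorted_wrt (\<ge>) ns}"

lemma finite_strict_indices [simp]: "finite (strict_indices n s)"
  by (rule finite_subset[OF _ finite_lists_length_eq[of "{1..n}" s]])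
     (auto simp: strict_indices_def)

lemma finite_weak_indices [simp]: "finite (weak_indices n s)"
  by (rule finite_subset[OF _ finite_lists_length_eq[of "{1..n}" s]])
     (auto simp: weak_indices_def)

definition zeta_sum :: "nat \<Rightarrow> nat list \<Rightarrow> real" where
  "zeta_sum n as =
     (\<Sum>ns \<in> strict_indices n (length as). \<Prod>j<length as. 1 / real (ns ! j) ^ (as ! j))"

definition t_sum :: "nat \<Rightarrow> nat list \<Rightarrow> real" where
  "t_sum n as =
     (\<Sum>ns \<in> strict_indices n (length as). \<Prod>j<length as. 1 / (2 * real (ns ! j) - 1) ^ (as ! j))"

definition t_star_sum :: "nat \<Rightarrow> nat list \<Rightarrow> real" where
  "t_star_sum n as =
     (\<Sum>ns \<in> weak_indices n (length as). \<Prod>j<length as. 1 / (2 * real (ns ! j) - 1) ^ (as ! j))"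

definition cmzv_partial :: "nat \<Rightarrow> nat list \<Rightarrow> complex list \<Rightarrow> complex" where
  "cmzv_partial N as zs =
     (\<Sum>ns \<in> strict_indices N (length as).
        \<Prod>j<length as. (zs ! j) ^ (ns ! j) / of_nat (ns ! j) ^ (as ! j))"

text \<open>
  If \<open>a\<^sub>1 = 1\<close> and \<open>z\<^sub>1 \<noteq> 1\<close>, the series defining a colored multiple zeta value
  converges only conditionally; its value is the limit of the truncations \<open>n\<^sub>1 \<le> N\<close>.
\<close>

definition has_cmzv :: "nat list \<Rightarrow> complex list \<Rightarrow> complex \<Rightarrow> bool" where
  "has_cmzv as zs x \<longleftrightarrow> (\<lambda>N. cmzv_partial N as zs) \<longlonglongrightarrow> x"

definition cmzv4_values :: "nat \<Rightarrow> complex set" where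
  "cmzv4_values w =
     {x. \<exists>as zs. length zs = length as \<and> (\<forall>a\<in>set as. a \<ge> 1) \<and> sum_list as = w \<and>
          (\<forall>z\<in>set zs. z ^ 4 = 1) \<and> (as \<noteq> [] \<longrightarrow> (hd as, hd zs) \<noteq> (1, 1)) \<and>
          has_cmzv as zs x}"

interpretation rat_complex: vector_space "\<lambda>(q::rat) (x::complex). of_rat q * x"
  by unfold_locales (simp_all add: algebra_simps of_rat_add of_rat_mult)

definition CMZV4 :: "nat \<Rightarrow> complex set" where
  "CMZV4 w = rat_complex.span (cmzv4_values w)"

end

theory Submission
  imports Defs
begin

text \<open>
  The coefficients of \<open>arcsin x ^ q / q!\<close> are, up to powers of 2, \<open>t\<^sub>n(2\<^sub>p\<^sub>-\<^sub>1)\<close> or \<open>\<zeta>\<^sub>n\<^sub>-\<^sub>1(2\<^sub>p\<^sub>-\<^sub>1)\<close>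
  times a central binomial factor. The second binomial factor, together with \<open>t\<^sup>\<star>\<^sub>n(1\<^sub>k)\<close> in the
  second series, is a moment \<open>\<integral> sin\<^sup>N \<theta> (- ln cos \<theta>)\<^sup>k / k! d\<theta> / sin \<theta>\<close> over \<open>(0, \<pi> / 2)\<close>, so each series
  is such an integral of an iterated integral of \<open>cot \<theta> d\<theta>\<close> starting from \<open>\<theta> ^ q / q!\<close>. In the variable
  \<open>t = tan (\<theta> / 2)\<close> the quantities \<open>\<i> \<theta>\<close>, \<open>- ln cos \<theta>\<close>, \<open>cot \<theta> d\<theta>\<close> and \<open>d\<theta> / sin \<theta>\<close> involve only the
  forms \<open>dt / t\<close> and \<open>z dt / (1 - z t)\<close> with \<open>z ^ 4 = 1\<close>. The rational span of iterated integrals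
  in these forms is closed under products (the shuffle relation), and their values at \<open>t = 1\<close> are
  colored multiple zeta values of level four.
\<close>

unbundle no vec_syntax and fps_syntax

text \<open>The iterated integrals are handled as formal power series in \<open>t\<close>, and
  integration against a form means inverting the Euler operator \<open>t * d/dt\<close>. The
  obstacle is the endpoint \<open>t = 1\<close>, where - ln cos \<theta> is unbounded and the series
  of a single word may fail to converge. With \<open>j\<close> integrations of cot \<theta>
  d\<theta> and \<open>k\<close> logarithms the weight is \<open>q + j + k + 1\<close>, the 1 being
  the last form. The two series have \<open>j = m - 1\<close>, with \<open>q = 2 * p - 1\<close>,
  \<open>k = 0\<close> in the first and \<open>q = 2 * p\<close> in the second. The forms produce
  \<i> \<theta> rather than \<theta>, hence a factor \<open>\<i> ^ q\<close>. For even
  \<open>q\<close> it is a sign; for odd \<open>q\<close> it is \<i> up to sign and, together with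
  the pi / 2 of Wallis' integral, it is the origin of \<i> / pi.\<close>

definition quartic_roots :: "complex set" where
  "quartic_roots = {z. z ^ 4 = 1}"

lemma finite_quartic_roots [simp]: "finite quartic_roots"
  unfolding quartic_roots_def by (rule finite_roots_unity) simp

lemma quartic_roots_members [simp]:
  "1 \<in> quartic_roots" "-1 \<in> quartic_roots" "\<i> \<in> quartic_roots" "-\<i> \<in> quartic_roots"
  by (simp_all add: quartic_roots_def)

lemma norm_quartic_root: "z \<in> quartic_roots \<Longrightarrow> norm z = 1"
  using power_eq_imp_eq_norm[of z 4 1] by (simp add: quartic_roots_def)

lemma quartic_root_divide: "y \<in> quartic_roots \<Longrightarrow> z \<in> quartic_roots \<Longrightarrow> y / z \<in> quartic_roots"
  by (simp add: quartic_roots_def power_divide)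

section \<open>The Euler operator on formal power series\<close>

definition fps_euler :: "complex fps \<Rightarrow> complex fps" where
  "fps_euler f = fps_X * fps_deriv f"

text \<open>Division by zero gives zero, so this is the primitive against \<open>dt / t\<close> that
  vanishes at \<open>0\<close>. It inverts \<open>fps_euler\<close> on series without constant
  term.\<close>

definition fps_euler_inv :: "complex fps \<Rightarrow> complex fps" where
  "fps_euler_inv f = Abs_fps (\<lambda>n. f $ n / of_nat n)"

text \<open>The Taylor series of \<open>z t / (1 - z t)\<close>, which is the quotient of the form
  \<open>z dt / (1 - z t)\<close> by \<open>dt / t\<close>.\<close>

definition geom_kernel :: "complex \<Rightarrow> complex fps" where
  "geom_kernel z = Abs_fps (\<lambda>n. if n = 0 then 0 else z ^ n)"

lemma fps_euler_nth [simp]: "fps_euler f $ n = of_nat n * f $ n"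
  by (cases n) (simp_all add: fps_euler_def)

lemma fps_euler_inv_nth [simp]: "fps_euler_inv f $ n = f $ n / of_nat n"
  by (simp add: fps_euler_inv_def)

lemma geom_kernel_nth [simp]: "geom_kernel z $ n = (if n = 0 then 0 else z ^ n)"
  by (simp add: geom_kernel_def)

lemma fps_euler_add: "fps_euler (f + g) = fps_euler f + fps_euler g"
  by (simp add: fps_euler_def algebra_simps)

lemma fps_euler_mult: "fps_euler (f * g) = fps_euler f * g + f * fps_euler g"
  by (simp add: fps_euler_def algebra_simps)

lemma fps_euler_inv_add: "fps_euler_inv (f + g) = fps_euler_inv f + fps_euler_inv g"
  by (rule fps_ext) (simp add: add_divide_distrib)

lemma fps_euler_inv_scale: "fps_euler_inv (fps_const c * f) = fps_const c * fps_euler_inv f"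
  by (rule fps_ext) simp

lemma fps_euler_inv_sum: "fps_euler_inv (\<Sum>x\<in>A. f x) = (\<Sum>x\<in>A. fps_euler_inv (f x))"
  by (rule fps_ext) (simp add: fps_sum_nth sum_divide_distrib)

lemma fps_euler_inv_euler: "f $ 0 = 0 \<Longrightarrow> fps_euler_inv (fps_euler f) = f"
  by (rule fps_ext) auto

lemma fps_euler_euler_inv: "f $ 0 = 0 \<Longrightarrow> fps_euler (fps_euler_inv f) = f"
  by (rule fps_ext) auto

section \<open>The shuffle algebra of iterated integrals of level four\<close>

text \<open>Taylor series at \<open>0\<close> of the rational span of iterated integrals of length \<open>w\<close> in the forms
  \<open>dt / t\<close> and \<open>z dt / (1 - z t)\<close> with \<open>z ^ 4 = 1\<close>.\<close>

primrec polylog4 :: "nat \<Rightarrow> complex fps set" where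
  "polylog4 0 = range (\<lambda>r::rat. fps_const (of_rat r))"
| "polylog4 (Suc w) =
     {f. f $ 0 = 0 \<and> (\<exists>g h. g \<in> polylog4 w \<and> g $ 0 = 0 \<and> (\<forall>z\<in>quartic_roots. h z \<in> polylog4 w) \<and>
           fps_euler f = g + (\<Sum>z\<in>quartic_roots. geom_kernel z * h z))}"

lemma polylog4_SucI:
  assumes "f $ 0 = 0" "g \<in> polylog4 w" "g $ 0 = 0" "\<And>z. z \<in> quartic_roots \<Longrightarrow> h z \<in> polylog4 w"
    "fps_euler f = g + (\<Sum>z\<in>quartic_roots. geom_kernel z * h z)"
  shows "f \<in> polylog4 (Suc w)"
  using assms by auto

lemma polylog4_SucE:
  assumes "f \<in> polylog4 (Suc w)"
  obtains g h where "f $ 0 = 0" "g \<in> polylog4 w" "g $ 0 = 0"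
    "\<And>z. z \<in> quartic_roots \<Longrightarrow> h z \<in> polylog4 w"
    "fps_euler f = g + (\<Sum>z\<in>quartic_roots. geom_kernel z * h z)"
  using assms by auto

lemma polylog4_add: "f \<in> polylog4 w \<Longrightarrow> g \<in> polylog4 w \<Longrightarrow> f + g \<in> polylog4 w"
proof (induction w arbitrary: f g)
  case 0
  then obtain r s :: rat where "f = fps_const (of_rat r)" "g = fps_const (of_rat s)" by auto
  then have "f + g = fps_const (of_rat (r + s))" by (simp add: of_rat_add)
  then show ?case by simp
next
  case (Suc w)
  obtain f0 fz where f: "f $ 0 = 0" "f0 \<in> polylog4 w" "f0 $ 0 = 0"
    "\<And>z. z \<in> quartic_roots \<Longrightarrow> fz z \<in> polylog4 w"
    "fps_euler f = f0 + (\<Sum>z\<in>quartic_roots. geom_kernel z * fz z)"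
    using Suc.prems(1) by (rule polylog4_SucE) blast
  obtain g0 gz where g: "g $ 0 = 0" "g0 \<in> polylog4 w" "g0 $ 0 = 0"
    "\<And>z. z \<in> quartic_roots \<Longrightarrow> gz z \<in> polylog4 w"
    "fps_euler g = g0 + (\<Sum>z\<in>quartic_roots. geom_kernel z * gz z)"
    using Suc.prems(2) by (rule polylog4_SucE) blast
  show ?case
    by (rule polylog4_SucI[where g = "f0 + g0" and h = "\<lambda>z. fz z + gz z"])
       (use f g in \<open>simp_all add: Suc.IH fps_euler_add sum.distrib algebra_simps\<close>)
qed

lemma polylog4_scale: "f \<in> polylog4 w \<Longrightarrow> fps_const (of_rat r) * f \<in> polylog4 w"
proof (induction w arbitrary: f)
  case 0
  then obtain s :: rat where "f = fps_const (of_rat s)" by auto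
  then have "fps_const (of_rat r) * f = fps_const (of_rat (r * s))" by (simp add: of_rat_mult)
  then show ?case by simp
next
  case (Suc w)
  obtain f0 fz where f: "f $ 0 = 0" "f0 \<in> polylog4 w" "f0 $ 0 = 0"
    "\<And>z. z \<in> quartic_roots \<Longrightarrow> fz z \<in> polylog4 w"
    "fps_euler f = f0 + (\<Sum>z\<in>quartic_roots. geom_kernel z * fz z)"
    using Suc.prems(1) by (rule polylog4_SucE) blast
  have "fps_euler (fps_const (of_rat r) * f) = fps_const (of_rat r) * fps_euler f"
    by (rule fps_ext) simp
  also have "\<dots> = fps_const (of_rat r) * f0 + (\<Sum>z\<in>quartic_roots. geom_kernel z * (fps_const (of_rat r) * fz z))"
    by (simp add: f(5) algebra_simps sum_distrib_left)
  finally show ?case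
    by (rule polylog4_SucI[rotated 4]) (use f Suc.IH in simp_all)
qed

lemma polylog4_zero [simp]: "0 \<in> polylog4 w"
proof (induction w)
  case 0
  show ?case by (auto intro!: range_eqI[of _ _ 0])
next
  case (Suc w)
  show ?case
    by (rule polylog4_SucI[where g = 0 and h = "\<lambda>z. 0"]) (use Suc in \<open>auto simp: fps_euler_def\<close>)
qed

lemma polylog4_one: "1 \<in> polylog4 0"
  by (auto intro!: range_eqI[of _ _ 1])

text \<open>The shuffle product in differential form: by the Leibniz rule, each term of the Euler
  derivative of \<open>f * g\<close> has one factor lowered in weight. Either factor may be the one
  that drops, so the induction is on the sum of the weights.\<close>

lemma polylog4_mult: "f \<in> polylog4 a \<Longrightarrow> g \<in> polylog4 b \<Longrightarrow> f * g \<in> polylog4 (a + b)"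
proof (induction "a + b" arbitrary: a b f g)
  case 0
  then have "a = 0" "b = 0" by auto
  with "0.prems" obtain r :: rat where f: "f = fps_const (of_rat r)" by auto
  show ?case unfolding f using "0.prems" \<open>a = 0\<close> by (simp only: polylog4_scale add_0)
next
  case (Suc w)
  consider "a = 0" | "b = 0" | a' b' where "a = Suc a'" "b = Suc b'"
    by (cases a; cases b) auto
  then show ?case
  proof cases
    case 1
    with Suc.prems obtain r :: rat where f: "f = fps_const (of_rat r)" by auto
    show ?thesis unfolding f using Suc.prems 1 by (simp only: polylog4_scale add_0)
  next
    case 2
    with Suc.prems obtain r :: rat where g: "g = fps_const (of_rat r)" by auto
    show ?thesis unfolding g mult.commute[of f] using Suc.prems 2
      by (simp only: polylog4_scale add_0_right)
  next
    case 3
    obtain f0 fz where f: "f $ 0 = 0" "f0 \<in> polylog4 a'" "f0 $ 0 = 0"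
      "\<And>z. z \<in> quartic_roots \<Longrightarrow> fz z \<in> polylog4 a'"
      "fps_euler f = f0 + (\<Sum>z\<in>quartic_roots. geom_kernel z * fz z)"
      using Suc.prems(1) unfolding 3 by (rule polylog4_SucE) blast
    obtain g0 gz where g: "g $ 0 = 0" "g0 \<in> polylog4 b'" "g0 $ 0 = 0"
      "\<And>z. z \<in> quartic_roots \<Longrightarrow> gz z \<in> polylog4 b'"
      "fps_euler g = g0 + (\<Sum>z\<in>quartic_roots. geom_kernel z * gz z)"
      using Suc.prems(2) unfolding 3 by (rule polylog4_SucE) blast
    have w: "w = a' + b" "w = a + b'" using 3 Suc.hyps(2) by auto
    have 1: "u * g \<in> polylog4 w" if "u \<in> polylog4 a'" for u
      using Suc.hyps(1)[OF w(1) that Suc.prems(2)] w by simp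
    have 2: "f * u \<in> polylog4 w" if "u \<in> polylog4 b'" for u
      using Suc.hyps(1)[OF w(2) Suc.prems(1) that] w by simp
    have "fps_euler (f * g) = (f0 * g + f * g0) + (\<Sum>z\<in>quartic_roots. geom_kernel z * (fz z * g + f * gz z))"
      unfolding fps_euler_mult f(5) g(5)
      by (simp add: algebra_simps sum.distrib sum_distrib_left)
    then have "f * g \<in> polylog4 (Suc w)"
      by (rule polylog4_SucI[rotated 4]) (use f g in \<open>auto intro!: polylog4_add 1 2\<close>)
    then show ?thesis using Suc.hyps(2) by simp
  qed
qed

lemma polylog4_power: "f \<in> polylog4 a \<Longrightarrow> f ^ k \<in> polylog4 (a * k)"
  by (induction k) (auto dest: polylog4_mult simp: polylog4_one simp del: polylog4.simps)

subsection \<open>Word series\<close>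

text \<open>A nested sum graded by its largest index: the coefficient of \<open>t ^ n\<close>
  collects the terms with \<open>n_1 = n\<close>. The empty word is \<open>1\<close>, a term at
  index \<open>0\<close>, so the innermost sum over \<open>l < n\<close> meets it exactly
  once.\<close>

fun word_series :: "nat list \<Rightarrow> complex list \<Rightarrow> complex fps" where
  "word_series (a # as) (z # zs) =
     Abs_fps (\<lambda>n. if n = 0 then 0 else z ^ n / of_nat n ^ a * (\<Sum>l<n. word_series as zs $ l))"
| "word_series _ _ = 1"

definition words :: "nat \<Rightarrow> (nat list \<times> complex list) set" where
  "words w = {(as, zs). length zs = length as \<and> (\<forall>a\<in>set as. a \<ge> 1) \<and> sum_list as = w \<and>
                set zs \<subseteq> quartic_roots}"

interpretation rat_fps: vector_space "\<lambda>(q::rat) (f::complex fps). fps_const (of_rat q) * f"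
  by unfold_locales (simp_all add: algebra_simps of_rat_add of_rat_mult flip: fps_const_add fps_const_mult)

definition word_span :: "nat \<Rightarrow> complex fps set" where
  "word_span w = rat_fps.span (case_prod word_series ` words w)"

text \<open>Leading exponent at least 2 gives absolute convergence at \<open>t = 1\<close>. In
  weight \<open>0\<close> the value \<open>hd []\<close> is unspecified, hence the assumptions of
  positive weight below.\<close>

definition admissible_span :: "nat \<Rightarrow> complex fps set" where
  "admissible_span w = rat_fps.span (case_prod word_series ` {(as, zs) \<in> words w. hd as \<ge> 2})"

text \<open>Dividing the n-th coefficient by \<open>n\<close> increases the leading exponent, which
  is at least 1, by one. Positive weight ensures that there is a leading exponent.\<close>

lemma fps_euler_inv_in_admissible_span:
  assumes "f \<in> word_span (Suc w)"
  shows "fps_euler_inv f \<in> admissible_span (Suc (Suc w))"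
  using assms unfolding word_span_def
proof (induction rule: rat_fps.span_induct_alt)
  case base
  have "fps_euler_inv 0 = 0" by (rule fps_ext) simp
  then show ?case by (simp add: admissible_span_def rat_fps.span_zero)
next
  case (step c x y)
  then obtain as zs where x: "x = word_series as zs" "(as, zs) \<in> words (Suc w)" by auto
  then obtain a as' z zs' where az: "as = a # as'" "zs = z # zs'"
    by (cases as; cases zs) (auto simp: words_def)
  have "fps_euler_inv x = word_series (Suc a # as') (z # zs')"
    unfolding x az by (rule fps_ext) (simp add: field_simps)
  moreover have "(Suc a # as', z # zs') \<in> words (Suc (Suc w))" "Suc a \<ge> 2"
    using x by (auto simp: words_def az)
  ultimately have "fps_euler_inv x \<in> admissible_span (Suc (Suc w))"
    unfolding admissible_span_def
    by (intro rat_fps.span_base image_eqI[of _ _ "(Suc a # as', z # zs')"]) auto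
  with step show ?case
    unfolding fps_euler_inv_add fps_euler_inv_scale admissible_span_def
    by (intro rat_fps.span_add rat_fps.span_scale)
qed

lemma admissible_span_subset: "admissible_span w \<subseteq> word_span w"
  unfolding admissible_span_def word_span_def by (intro rat_fps.span_mono) auto

lemma geom_kernel_mult_nth:
  "(geom_kernel z * f) $ n = (\<Sum>l<n. z ^ (n - l) * f $ l)"
proof -
  have "(geom_kernel z * f) $ n = (\<Sum>l\<in>{0..n}. f $ l * geom_kernel z $ (n - l))"
    by (subst mult.commute) (simp only: fps_mult_nth)
  also have "\<dots> = (\<Sum>l<n. f $ l * geom_kernel z $ (n - l))"
    by (simp add: atLeast0AtMost lessThan_Suc_atMost[symmetric])
  also have "\<dots> = (\<Sum>l<n. z ^ (n - l) * f $ l)"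
    by (intro sum.cong) auto
  finally show ?thesis .
qed

text \<open>The n-th coefficient of the product is \<open>z ^ n\<close> times the sum over
  \<open>l < n\<close> of \<open>x $ l / z ^ l\<close>. The outer factor, divided by
  \<open>n\<close>, is a new leading letter with exponent 1 and root \<open>z\<close>; the inner one
  turns the old leading root \<open>y\<close> into \<open>y / z\<close>, again a fourth root of
  unity.\<close>

lemma geom_kernel_in_word_span:
  assumes "f \<in> word_span w" "z \<in> quartic_roots"
  shows "fps_euler_inv (geom_kernel z * f) \<in> word_span (Suc w)"
  using assms(1) unfolding word_span_def
proof (induction rule: rat_fps.span_induct_alt)
  case base
  have "fps_euler_inv 0 = 0" by (rule fps_ext) simp
  then show ?case by (simp add: rat_fps.span_zero)
next
  case (step c x y)
  then obtain as zs where x: "x = word_series as zs" "(as, zs) \<in> words w" by auto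
  have z: "z \<noteq> 0" using assms(2) by (auto simp: quartic_roots_def)
  have "\<exists>as' zs'. fps_euler_inv (geom_kernel z * x) = word_series as' zs' \<and> (as', zs') \<in> words (Suc w)"
  proof (cases as)
    case Nil
    with x have "zs = []" by (auto simp: words_def)
    have "fps_euler_inv (geom_kernel z * x) = word_series [1] [z]"
    proof (rule fps_ext)
      fix n
      have "(\<Sum>l<n. z ^ (n - l) * x $ l) = (\<Sum>l<n. if l = 0 then z ^ n else 0)"
        by (intro sum.cong) (auto simp: x Nil)
      moreover have "(\<Sum>l<n. word_series [] [] $ l) = (\<Sum>l<n. if l = 0 then 1 else 0)"
        by (intro sum.cong) auto
      ultimately show "fps_euler_inv (geom_kernel z * x) $ n = word_series [1] [z] $ n"
        by (cases "n = 0") (simp_all add: geom_kernel_mult_nth)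
    qed
    moreover have "([1], [z]) \<in> words (Suc w)" using x Nil assms(2) by (auto simp: words_def)
    ultimately show ?thesis by blast
  next
    case (Cons b bs)
    then obtain y ys where zs: "zs = y # ys" using x by (cases zs) (auto simp: words_def)
    have "fps_euler_inv (geom_kernel z * x) = word_series (1 # b # bs) (z # (y / z) # ys)"
    proof (rule fps_ext)
      fix n
      have "(\<Sum>l<n. z ^ (n - l) * x $ l) = z ^ n * (\<Sum>l<n. word_series (b # bs) ((y / z) # ys) $ l)"
        unfolding sum_distrib_left
        by (intro sum.cong) (use z in \<open>auto simp: x Cons zs power_diff field_simps\<close>)
      then show "fps_euler_inv (geom_kernel z * x) $ n = word_series (1 # b # bs) (z # (y / z) # ys) $ n"
        unfolding word_series.simps(1)[of 1] by (simp add: geom_kernel_mult_nth del: word_series.simps)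
    qed
    moreover have "(1 # b # bs, z # (y / z) # ys) \<in> words (Suc w)"
      using x assms(2) by (auto simp: words_def Cons zs quartic_root_divide)
    ultimately show ?thesis by blast
  qed
  then obtain as' zs' where "fps_euler_inv (geom_kernel z * x) = word_series as' zs'"
    "(as', zs') \<in> words (Suc w)" by blast
  then have "fps_euler_inv (geom_kernel z * x) \<in> rat_fps.span (case_prod word_series ` words (Suc w))"
    by (intro rat_fps.span_base image_eqI[of _ _ "(as', zs')"]) simp_all
  moreover have "fps_euler_inv (geom_kernel z * (fps_const (of_rat c) * x + y)) =
      fps_const (of_rat c) * fps_euler_inv (geom_kernel z * x) + fps_euler_inv (geom_kernel z * y)"
    by (simp add: distrib_left fps_euler_inv_add mult.left_commute[of "geom_kernel z"] fps_euler_inv_scale)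
  ultimately show ?case
    using step.IH by (simp only: rat_fps.span_add rat_fps.span_scale)
qed

lemma polylog4_subset_word_span: "f \<in> polylog4 w \<Longrightarrow> f \<in> word_span w"
proof (induction w arbitrary: f)
  case 0
  then obtain r :: rat where f: "f = fps_const (of_rat r)" by auto
  have "(1::complex fps) \<in> word_span 0"
    unfolding word_span_def
    by (intro rat_fps.span_base image_eqI[of _ _ "([], [])"]) (auto simp: words_def)
  then show ?case
    using rat_fps.span_scale[of 1 _ r] by (simp add: f word_span_def)
next
  case (Suc w)
  obtain f0 fz where f: "f $ 0 = 0" "f0 \<in> polylog4 w" "f0 $ 0 = 0"
    "\<And>z. z \<in> quartic_roots \<Longrightarrow> fz z \<in> polylog4 w"
    "fps_euler f = f0 + (\<Sum>z\<in>quartic_roots. geom_kernel z * fz z)"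
    using Suc.prems(1) by (rule polylog4_SucE) blast
  have 1: "fps_euler_inv f0 \<in> word_span (Suc w)"
  proof (cases w)
    \<comment> \<open>A constant that vanishes at \<open>0\<close> is zero. Without this condition
      on \<open>g\<close> in the definition, \<open>dt / t\<close> would bring in the logarithm of
      \<open>t\<close>.\<close>
    case 0
    with f have "f0 = 0" by auto
    then have "fps_euler_inv f0 = 0" by (intro fps_ext) auto
    then show ?thesis by (simp add: word_span_def rat_fps.span_zero)
  next
    case (Suc v)
    then show ?thesis
      using fps_euler_inv_in_admissible_span admissible_span_subset Suc.IH f by blast
  qed
  have "f = fps_euler_inv f0 + (\<Sum>z\<in>quartic_roots. fps_euler_inv (geom_kernel z * fz z))"
    using fps_euler_inv_euler[OF f(1)] unfolding f(5) by (simp add: fps_euler_inv_add fps_euler_inv_sum)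
  also have "\<dots> \<in> word_span (Suc w)"
    unfolding word_span_def
    by (intro rat_fps.span_add rat_fps.span_sum)
       (use 1 geom_kernel_in_word_span Suc.IH f in \<open>auto simp: word_span_def\<close>)
  finally show ?case .
qed

subsection \<open>Values at one\<close>

lemma strict_indices_0: "strict_indices N 0 = {[]}"
  by (auto simp: strict_indices_def)

lemma strict_indices_Suc:
  "strict_indices N (Suc s) = (\<Union>n\<in>{1..N}. (#) n ` strict_indices (n - 1) s)"
proof (intro equalityI subsetI)
  fix xs assume "xs \<in> strict_indices N (Suc s)"
  then obtain n ns where ns: "xs = n # ns" "length ns = s" "n \<in> {1..N}" "set ns \<subseteq> {1..N}"
     "\<forall>x\<in>set ns. x < n" "sorted_wrt (>) ns"
    unfolding strict_indices_def by (cases xs) auto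
  then have "ns \<in> strict_indices (n - 1) s"
    unfolding strict_indices_def by fastforce
  with ns show "xs \<in> (\<Union>n\<in>{1..N}. (#) n ` strict_indices (n - 1) s)"
    by blast
next
  fix xs assume "xs \<in> (\<Union>n\<in>{1..N}. (#) n ` strict_indices (n - 1) s)"
  then obtain n ns where ns: "xs = n # ns" "n \<in> {1..N}" "ns \<in> strict_indices (n - 1) s"
    by blast
  then have "x < n" "x \<in> {1..N}" if "x \<in> set ns" for x
    using that by (fastforce simp: strict_indices_def)+
  with ns show "xs \<in> strict_indices N (Suc s)"
    unfolding strict_indices_def by auto
qed

lemma sum_strict_indices_Suc:
  fixes f :: "nat list \<Rightarrow> 'a::comm_monoid_add"
  shows "(\<Sum>ns\<in>strict_indices N (Suc s). f ns) =
         (\<Sum>n=1..N. \<Sum>ns\<in>strict_indices (n - 1) s. f (n # ns))"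
  unfolding strict_indices_Suc
  by (subst sum.UNION_disjoint) (auto simp: sum.reindex)

lemma cmzv_partial_Cons:
  "cmzv_partial N (a # as) (z # zs) = (\<Sum>n=1..N. z ^ n / of_nat n ^ a * cmzv_partial (n - 1) as zs)"
  by (simp add: cmzv_partial_def sum_strict_indices_Suc sum_distrib_left prod.lessThan_Suc_shift
      del: prod.lessThan_Suc)

text \<open>Truncation at \<open>n_1 \<le> N\<close> cuts the power series after
  \<open>t ^ N\<close>. The limit defining a colored multiple zeta value is therefore the sum of the
  coefficients, the value at \<open>t = 1\<close>.\<close>

lemma cmzv_partial_eq_sum_word_series:
  "length zs = length as \<Longrightarrow> cmzv_partial N as zs = (\<Sum>n\<le>N. word_series as zs $ n)"
proof (induction as arbitrary: zs N)
  case Nil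
  then show ?case
    by (cases zs) (simp_all add: cmzv_partial_def strict_indices_0 sum.atMost_shift)
next
  case (Cons a as)
  then obtain z zs' where zs: "zs = z # zs'" "length zs' = length as" by (cases zs) auto
  have "(\<Sum>n\<le>N. word_series (a # as) zs $ n) = (\<Sum>n\<in>{1..N}. word_series (a # as) zs $ n)"
    by (rule sum.mono_neutral_right) (auto simp: zs)
  also have "\<dots> = cmzv_partial N (a # as) zs"
    unfolding zs cmzv_partial_Cons
  proof (intro sum.cong refl)
    fix n assume "n \<in> {1..N}"
    then have "{..n - 1} = {..<n}" by auto
    with \<open>n \<in> {1..N}\<close> show "word_series (a # as) (z # zs') $ n = z ^ n / of_nat n ^ a * cmzv_partial (n - 1) as zs'"
      using Cons.IH[OF zs(2)] by simp
  qed
  finally show ?case by simp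
qed

text \<open>The roots have modulus one and the exponents are at least 1, so each letter costs at
  most one harmonic sum: the growth is only a power of a logarithm.\<close>

lemma word_series_partial_sum_le:
  assumes "length zs = length as" "\<forall>a\<in>set as. a \<ge> 1" "set zs \<subseteq> quartic_roots"
  shows "(\<Sum>l<n. norm (word_series as zs $ l)) \<le> (1 + harm n) ^ length as"
  using assms
proof (induction as arbitrary: zs n)
  case Nil
  have "(\<Sum>l<n. norm (word_series [] zs $ l)) = (\<Sum>l<n. if l = 0 then 1 else 0)"
    by (intro sum.cong) auto
  then show ?case by simp
next
  case (Cons a as)
  then obtain z zs' where zs: "zs = z # zs'" "length zs' = length as" by (cases zs) auto
  have le: "norm (word_series (a # as) zs $ l) \<le> inverse (real l) * (1 + harm n) ^ length as"
    if "l < n" "l \<ge> 1" for l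
  proof -
    have "norm (\<Sum>i<l. word_series as zs' $ i) \<le> (\<Sum>i<l. norm (word_series as zs' $ i))"
      by (rule norm_sum)
    also have "\<dots> \<le> (1 + harm l) ^ length as"
      using Cons.IH[OF zs(2)] Cons.prems zs by auto
    also have "\<dots> \<le> (1 + harm n) ^ length as"
      using that by (intro power_mono add_mono harm_mono) (auto intro: add_nonneg_nonneg harm_nonneg)
    finally have *: "norm (\<Sum>i<l. word_series as zs' $ i) \<le> (1 + harm n) ^ length as" .
    have "norm (z ^ l / of_nat l ^ a) \<le> inverse (real l)"
    proof -
      have "real l ^ 1 \<le> real l ^ a" using that Cons.prems by (intro power_increasing) auto
      with that show ?thesis
        using Cons.prems zs by (auto simp: norm_divide norm_power norm_quartic_root field_simps)
    qed
    moreover have "word_series (a # as) zs $ l = z ^ l / of_nat l ^ a * (\<Sum>i<l. word_series as zs' $ i)"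
      using that by (simp add: zs)
    ultimately show ?thesis
      using * by (simp only: norm_mult) (intro mult_mono, auto)
  qed
  have "(\<Sum>l<n. norm (word_series (a # as) zs $ l)) = (\<Sum>l\<in>{1..<n}. norm (word_series (a # as) zs $ l))"
    by (rule sum.mono_neutral_right) (auto simp: zs)
  also have "\<dots> \<le> (\<Sum>l\<in>{1..<n}. inverse (real l) * (1 + harm n) ^ length as)"
    by (intro sum_mono le) auto
  also have "\<dots> \<le> (\<Sum>l\<in>{1..n}. inverse (real l) * (1 + harm n) ^ length as)"
    by (intro sum_mono2) (auto intro!: mult_nonneg_nonneg zero_le_power add_nonneg_nonneg harm_nonneg)
  also have "\<dots> = harm n * (1 + harm n) ^ length as"
    by (simp add: harm_def sum_distrib_right)
  also have "\<dots> \<le> (1 + harm n) * (1 + harm n) ^ length as"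
    by (intro mult_right_mono zero_le_power add_nonneg_nonneg harm_nonneg) auto
  finally show ?case by simp
qed

lemma harm_le_one_plus_ln: "n > 0 \<Longrightarrow> (harm n :: real) \<le> 1 + ln (real n)"
  using euler_mascheroni_sequence_decreasing[of 1 n] by (simp add: harm_def)

text \<open>This is \<open>u ^ s \<le> exp u\<close> for large \<open>u\<close>, taken at
  \<open>u = 1 + ln n / 2\<close>: there \<open>2 * u = 2 + ln n\<close>, which dominates
  \<open>1 + harm n\<close>, and \<open>exp u = exp 1 * sqrt n\<close>.\<close>

lemma eventually_log_power_le_sqrt:
  "eventually (\<lambda>n. (2 + ln (real n)) ^ s \<le> 2 ^ s * exp 1 * sqrt (real n)) sequentially"
proof -
  have "filterlim (\<lambda>n. 1 + ln (real n) / 2) at_top sequentially"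
    by (intro filterlim_tendsto_add_at_top[OF tendsto_const]
        filterlim_at_top_mult_tendsto_pos[OF tendsto_const, of "1/2", simplified]
        filterlim_compose[OF ln_at_top filterlim_real_sequentially])
  from filterlim_compose[OF tendsto_power_div_exp_0 this, of s]
  have "eventually (\<lambda>n. (1 + ln (real n) / 2) ^ s / exp (1 + ln (real n) / 2) < 1) sequentially"
    by (rule order_tendstoD) simp
  then show ?thesis
    using eventually_gt_at_top[of 0]
  proof eventually_elim
    case (elim n)
    have "exp (ln (real n) / 2) = sqrt (real n)"
      using elim by (simp add: powr_half_sqrt[symmetric] powr_def)
    then have "(1 + ln (real n) / 2) ^ s \<le> exp 1 * sqrt (real n)"
      using elim by (simp add: exp_add)
    then have "2 ^ s * (1 + ln (real n) / 2) ^ s \<le> 2 ^ s * (exp 1 * sqrt (real n))"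
      by (intro mult_left_mono) auto
    also have "2 ^ s * (1 + ln (real n) / 2) ^ s = (2 + ln (real n)) ^ s"
      by (simp add: power_mult_distrib[symmetric])
    finally show ?case by simp
  qed
qed

text \<open>The leading letter gives at most \<open>1 / n ^ 2\<close> and the inner nested sum is of
  order at most \<open>sqrt n\<close>, whence the exponent \<open>-3/2\<close>.\<close>

lemma word_series_summable:
  assumes "(as, zs) \<in> words w" "hd as \<ge> 2" "w > 0"
  shows "summable (\<lambda>n. norm (word_series as zs $ n))"
proof -
  obtain a as' z zs' where az: "as = a # as'" "zs = z # zs'"
    using assms by (cases as; cases zs) (auto simp: words_def)
  define s where "s = length as'"
  have "eventually (\<lambda>n. norm (norm (word_series as zs $ n)) \<le> 2 ^ s * exp 1 * real n powr (-3/2)) sequentially"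
    using eventually_log_power_le_sqrt[of s] eventually_gt_at_top[of 0]
  proof eventually_elim
    case (elim n)
    have "norm (\<Sum>i<n. word_series as' zs' $ i) \<le> (\<Sum>i<n. norm (word_series as' zs' $ i))"
      by (rule norm_sum)
    also have "\<dots> \<le> (1 + harm n) ^ s"
      unfolding s_def using assms by (intro word_series_partial_sum_le) (auto simp: words_def az)
    also have "\<dots> \<le> (2 + ln (real n)) ^ s"
      using harm_le_one_plus_ln[of n] elim by (intro power_mono) (auto intro: add_nonneg_nonneg harm_nonneg)
    also have "\<dots> \<le> 2 ^ s * exp 1 * sqrt (real n)" by fact
    finally have *: "norm (\<Sum>i<n. word_series as' zs' $ i) \<le> 2 ^ s * exp 1 * sqrt (real n)" .
    have "real n ^ 2 \<le> real n ^ a" using elim assms az by (intro power_increasing) auto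
    moreover have "z \<in> quartic_roots" using assms by (auto simp: words_def az)
    ultimately have "norm (z ^ n / of_nat n ^ a) \<le> 1 / real n ^ 2"
      using elim by (auto simp: norm_divide norm_power norm_quartic_root intro!: divide_left_mono)
    moreover have "word_series as zs $ n = z ^ n / of_nat n ^ a * (\<Sum>i<n. word_series as' zs' $ i)"
      using elim by (simp add: az)
    ultimately have "norm (word_series as zs $ n) \<le> 1 / real n ^ 2 * (2 ^ s * exp 1 * sqrt (real n))"
      using * by (simp only: norm_mult) (intro mult_mono, auto)
    also have "\<dots> = 2 ^ s * exp 1 * (real n powr (-2) * real n powr (1/2))"
      using elim by (simp add: powr_half_sqrt powr_minus_divide powr_numeral)
    also have "\<dots> = 2 ^ s * exp 1 * real n powr (-3/2)"
      by (simp add: powr_add[symmetric])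
    finally show ?case by simp
  qed
  moreover have "summable (\<lambda>n. 2 ^ s * exp 1 * real n powr (-3/2))"
    by (intro summable_mult) (simp add: summable_real_powr_iff)
  ultimately show ?thesis by (rule summable_comparison_test_ev)
qed

lemma word_series_value:
  assumes "(as, zs) \<in> words w" "hd as \<ge> 2" "w > 0"
  shows "(\<Sum>n. word_series as zs $ n) \<in> cmzv4_values w"
proof -
  have "summable (\<lambda>n. word_series as zs $ n)"
    using word_series_summable[OF assms] by (rule summable_norm_cancel)
  then have "has_cmzv as zs (\<Sum>n. word_series as zs $ n)"
    unfolding has_cmzv_def using assms(1)
    by (simp add: cmzv_partial_eq_sum_word_series words_def summable_LIMSEQ')
  with assms show ?thesis
    unfolding cmzv4_values_def by (force simp: words_def quartic_roots_def)
qed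

lemma admissible_span_value:
  assumes "f \<in> admissible_span w" "w > 0"
  shows "summable (\<lambda>n. norm (f $ n)) \<and> (\<Sum>n. f $ n) \<in> CMZV4 w"
  using assms(1) unfolding admissible_span_def
proof (induction rule: rat_fps.span_induct_alt)
  case base
  then show ?case by (simp add: CMZV4_def rat_complex.span_zero)
next
  case (step c x y)
  then obtain as zs where x: "x = word_series as zs" "(as, zs) \<in> words w" "hd as \<ge> 2" by auto
  have sx: "summable (\<lambda>n. norm (x $ n))" "(\<Sum>n. x $ n) \<in> CMZV4 w"
    using word_series_summable[OF x(2,3) assms(2)] word_series_value[OF x(2,3) assms(2)]
    by (simp_all add: x(1) CMZV4_def rat_complex.span_base)
  have "summable (\<lambda>n. norm ((fps_const (of_rat c) * x + y) $ n))"
  proof (rule summable_comparison_test')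
    show "summable (\<lambda>n. norm (of_rat c :: complex) * norm (x $ n) + norm (y $ n))"
      using sx step by (intro summable_add summable_mult) auto
    show "norm (norm ((fps_const (of_rat c) * x + y) $ n)) \<le> norm (of_rat c :: complex) * norm (x $ n) + norm (y $ n)"
      for n by (simp add: norm_mult[symmetric] norm_triangle_ineq)
  qed
  moreover have "(\<Sum>n. (fps_const (of_rat c) * x + y) $ n) = of_rat c * (\<Sum>n. x $ n) + (\<Sum>n. y $ n)"
    using sx(1) step.IH
    by (simp add: suminf_add[symmetric] suminf_mult summable_mult summable_norm_cancel)
  moreover have "of_rat c * (\<Sum>n. x $ n) + (\<Sum>n. y $ n) \<in> CMZV4 w"
    using sx(2) step.IH unfolding CMZV4_def
    by (intro rat_complex.span_add rat_complex.span_scale) auto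
  ultimately show ?case by simp
qed

text \<open>The sum is the value at \<open>1\<close> of the primitive of \<open>f\<close> against
  \<open>dt / t\<close>. That last integration supplies the admissibility which \<open>f\<close>
  itself may lack.\<close>

lemma polylog4_Suc_value:
  assumes "f \<in> polylog4 (Suc w)"
  shows "summable (\<lambda>n. norm (f $ n / of_nat n))" "(\<Sum>n. f $ n / of_nat n) \<in> CMZV4 (Suc (Suc w))"
  using admissible_span_value[OF fps_euler_inv_in_admissible_span[OF polylog4_subset_word_span[OF assms]]]
  by simp_all

subsection \<open>Powers of the arcsine\<close>

text \<open>The interval is half-open because the functions compared later include a logarithm
  unbounded at the right end and power series controlled only inside the unit disc.\<close>

lemma eq_if_same_vector_derivative:
  fixes f g :: "real \<Rightarrow> 'a::banach"
  assumes "continuous_on {a..<b} f" "continuous_on {a..<b} g" "f a = g a"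
    and "\<And>x. a < x \<Longrightarrow> x < b \<Longrightarrow> (f has_vector_derivative h x) (at x)"
    and "\<And>x. a < x \<Longrightarrow> x < b \<Longrightarrow> (g has_vector_derivative h x) (at x)"
    and "a \<le> x" "x < b"
  shows "f x = g x"
proof -
  have "continuous_on {a..x} (\<lambda>y. f y - g y)"
    using assms by (intro continuous_on_diff) (auto intro: continuous_on_subset)
  moreover have "((\<lambda>y. f y - g y) has_vector_derivative 0) (at y)" if "y \<in> {a<..<x}" for y
    using has_vector_derivative_diff[OF assms(4,5), of y] that assms by simp
  ultimately have "((\<lambda>y. 0) has_integral (f x - g x) - (f a - g a)) {a..x}"
    by (intro fundamental_theorem_of_calculus_interior) (use assms in auto)
  then show ?thesis
    using assms(3) has_integral_unique[OF has_integral_0] by fastforce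
qed

text \<open>The Taylor coefficients of \<open>arcsin x ^ q / fact q\<close>. With this function
  called \<open>y_q\<close>, the recursion is the equation
  \<open>(1 - x^2) y_q'' - x y_q' = y_(q-2)\<close> read off coefficientwise, and the first two
  values are the initial data at \<open>0\<close>.\<close>

fun arcsin_coeff :: "nat \<Rightarrow> nat \<Rightarrow> real" where
  "arcsin_coeff q 0 = (if q = 0 then 1 else 0)"
| "arcsin_coeff q (Suc 0) = (if q = 1 then 1 else 0)"
| "arcsin_coeff q (Suc (Suc n)) =
     (real n ^ 2 * arcsin_coeff q n + (if q \<ge> 2 then arcsin_coeff (q - 2) n else 0)) /
     (real (n + 2) * real (n + 1))"

text \<open>The induction closes because \<open>n^2 + 1 \<le> (n + 2) (n + 1)\<close>. The upper
  bound serves the radius of convergence, the sign serves the interchange of sum and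
  integral.\<close>

lemma arcsin_coeff_bounds: "0 \<le> arcsin_coeff q n \<and> arcsin_coeff q n \<le> 1"
proof (induction q n rule: arcsin_coeff.induct)
  case (3 q n)
  have "real n ^ 2 * arcsin_coeff q n + (if q \<ge> 2 then arcsin_coeff (q - 2) n else 0) \<le> real n ^ 2 * 1 + 1"
    using 3 by (intro add_mono mult_left_mono) auto
  also have "\<dots> \<le> real (n + 2) * real (n + 1)"
    by (simp add: algebra_simps power2_eq_square)
  finally show ?case using 3 by (auto simp: divide_simps)
qed auto

lemma arcsin_coeff_rec:
  "real (n + 1) * real (n + 2) * arcsin_coeff q (Suc (Suc n)) =
     real n ^ 2 * arcsin_coeff q n + (if q \<ge> 2 then arcsin_coeff (q - 2) n else 0)"
  by simp

declare arcsin_coeff.simps(3) [simp del]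

text \<open>Each factor \<open>1 / n\<close> is one integration against \<open>dx / x\<close>, which
  is cot \<theta> d\<theta> for x = sin \<theta>.\<close>

definition arcsin_fps :: "nat \<Rightarrow> nat \<Rightarrow> real fps" where
  "arcsin_fps q j = Abs_fps (\<lambda>n. arcsin_coeff q n / real n ^ j)"

lemma arcsin_fps_nth [simp]: "arcsin_fps q j $ n = arcsin_coeff q n / real n ^ j"
  by (simp add: arcsin_fps_def)

lemma abs_arcsin_fps_nth_le: "\<bar>arcsin_fps q j $ n\<bar> \<le> 1"
proof (cases "n = 0")
  case False
  then have "real n ^ j \<ge> 1" by simp
  with arcsin_coeff_bounds[of q n] show ?thesis by (auto simp: divide_simps)
qed (cases j; simp)

lemma fps_conv_radius_ge_1_if_bounded:
  fixes f :: "'a :: {banach, real_normed_div_algebra} fps"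
  assumes "\<And>n. norm (f $ n) \<le> 1"
  shows "fps_conv_radius f \<ge> 1"
  unfolding fps_conv_radius_def
proof (rule conv_radius_geI_ex')
  fix r :: real assume r: "0 < r" "ereal r < 1"
  show "summable (\<lambda>n. f $ n * of_real r ^ n)"
  proof (rule summable_comparison_test')
    show "summable (\<lambda>n. r ^ n)" using r by simp
    show "norm (f $ n * of_real r ^ n) \<le> r ^ n" for n
      using assms[of n] r by (simp add: norm_mult norm_power mult_left_le_one_le)
  qed
qed

lemma conv_radius_arcsin_fps: "fps_conv_radius (arcsin_fps q j) \<ge> 1"
  using abs_arcsin_fps_nth_le by (intro fps_conv_radius_ge_1_if_bounded) auto

lemma norm_less_conv_radius:
  fixes x :: "'a :: {banach, real_normed_div_algebra}"
  assumes "norm x < 1" "fps_conv_radius f \<ge> 1"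
  shows "ereal (norm x) < fps_conv_radius (f :: 'a fps)"
  using assms by (metis less_le_trans one_ereal_def less_ereal.simps(1))

lemma fps_deriv_conv_radius_ge_1:
  fixes f :: "'a :: {banach, real_normed_field} fps"
  shows "fps_conv_radius f \<ge> 1 \<Longrightarrow> fps_conv_radius (fps_deriv f) \<ge> 1"
  using fps_conv_radius_deriv order_trans by blast

lemma fps_add_conv_radius_ge_1:
  fixes f g :: "'a :: {banach, real_normed_div_algebra} fps"
  shows "fps_conv_radius f \<ge> 1 \<Longrightarrow> fps_conv_radius g \<ge> 1 \<Longrightarrow> fps_conv_radius (f + g) \<ge> 1"
  by (rule order_trans[OF min.boundedI fps_conv_radius_add])

lemma fps_mult_conv_radius_ge_1:
  fixes f g :: "'a :: {banach, real_normed_div_algebra, comm_ring_1} fps"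
  shows "fps_conv_radius f \<ge> 1 \<Longrightarrow> fps_conv_radius g \<ge> 1 \<Longrightarrow> fps_conv_radius (f * g) \<ge> 1"
  by (rule order_trans[OF min.boundedI fps_conv_radius_mult])

lemma DERIV_eval_fps:
  fixes f :: "real fps"
  assumes "fps_conv_radius f \<ge> 1" "\<bar>x\<bar> < 1"
  shows "(eval_fps f has_real_derivative eval_fps (fps_deriv f) x) (at x within A)"
  using assms by (intro has_field_derivative_eval_fps norm_less_conv_radius) auto

lemma arcsin_fps_ode:
  "fps_deriv (fps_deriv (arcsin_fps q 0)) =
     fps_X * (fps_deriv (arcsin_fps q 0) + fps_X * fps_deriv (fps_deriv (arcsin_fps q 0)))
     + (if q \<ge> 2 then arcsin_fps (q - 2) 0 else 0)"
proof (rule fps_ext)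
  fix n
  have *: "fps_deriv (fps_deriv (arcsin_fps q 0)) $ n = real (n + 1) * real (n + 2) * arcsin_coeff q (Suc (Suc n))"
    by (simp add: algebra_simps)
  have "(fps_X * (fps_deriv (arcsin_fps q 0) + fps_X * fps_deriv (fps_deriv (arcsin_fps q 0)))) $ n
    = real n ^ 2 * arcsin_coeff q n"
  proof (cases n)
    case (Suc m)
    then show ?thesis by (cases m) (simp_all add: algebra_simps power2_eq_square)
  qed simp
  then show "fps_deriv (fps_deriv (arcsin_fps q 0)) $ n =
     (fps_X * (fps_deriv (arcsin_fps q 0) + fps_X * fps_deriv (fps_deriv (arcsin_fps q 0)))
     + (if q \<ge> 2 then arcsin_fps (q - 2) 0 else 0)) $ n"
    unfolding * fps_add_nth arcsin_coeff_rec by simp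
qed

lemma eval_arcsin_fps_ode:
  assumes "\<bar>x\<bar> < 1"
  shows "(1 - x\<^sup>2) * eval_fps (fps_deriv (fps_deriv (arcsin_fps q 0))) x =
     x * eval_fps (fps_deriv (arcsin_fps q 0)) x + (if q \<ge> 2 then eval_fps (arcsin_fps (q - 2) 0) x else 0)"
proof -
  note r = conv_radius_arcsin_fps[of q 0] fps_deriv_conv_radius_ge_1[OF conv_radius_arcsin_fps[of q 0]]
    fps_deriv_conv_radius_ge_1[OF fps_deriv_conv_radius_ge_1[OF conv_radius_arcsin_fps[of q 0]]]
  define D where "D = fps_deriv (arcsin_fps q 0)"
  define E where "E = fps_deriv D"
  have rD: "fps_conv_radius D \<ge> 1" and rE: "fps_conv_radius E \<ge> 1" using r by (auto simp: D_def E_def)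
  have rXE: "fps_conv_radius (fps_X * E) \<ge> 1"
    using rE by (intro fps_mult_conv_radius_ge_1) auto
  have rDXE: "fps_conv_radius (D + fps_X * E) \<ge> 1"
    using rD rXE by (rule fps_add_conv_radius_ge_1)
  have rXDXE: "fps_conv_radius (fps_X * (D + fps_X * E)) \<ge> 1"
    using rDXE by (intro fps_mult_conv_radius_ge_1) auto
  define R where "R = (if q \<ge> 2 then arcsin_fps (q - 2) 0 else 0)"
  have rR: "fps_conv_radius R \<ge> 1" using conv_radius_arcsin_fps by (auto simp: R_def)
  have l: "ereal (norm x) < fps_conv_radius f" if "fps_conv_radius f \<ge> 1" for f :: "real fps"
    using norm_less_conv_radius[of x f] that assms by simp
  have "eval_fps E x = eval_fps (fps_X * (D + fps_X * E) + R) x"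
    using arcsin_fps_ode[of q] unfolding D_def E_def R_def by simp
  also have "\<dots> = x * (eval_fps D x + x * eval_fps E x) + eval_fps R x"
    using l[OF rD] l[OF rE] l[OF rXE] l[OF rDXE] l[OF rXDXE] l[OF rR]
    by (simp add: eval_fps_add eval_fps_mult)
  finally have "(1 - x\<^sup>2) * eval_fps E x = x * eval_fps D x + eval_fps R x"
    by (simp add: algebra_simps power2_eq_square)
  then show ?thesis by (simp add: D_def E_def R_def)
qed

text \<open>The second-order equation is integrated in two first-order steps. The function
  \<open>w = sqrt (1 - x^2) * y'\<close> has derivative \<open>y_(q-2) / sqrt (1 - x^2)\<close>,
  known by induction, so \<open>w\<close> is the arcsine power of order \<open>q - 1\<close>;
  dividing by the root gives \<open>y'\<close>, hence \<open>y\<close>.\<close>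

lemma eval_arcsin_fps_0:
  assumes "0 \<le> x" "x < 1"
  shows "eval_fps (arcsin_fps q 0) x = arcsin x ^ q / fact q"
  using assms
proof (induction q arbitrary: x rule: less_induct)
  case (less q)
  define y where "y = eval_fps (arcsin_fps q 0)"
  define y1 where "y1 = eval_fps (fps_deriv (arcsin_fps q 0))"
  define y2 where "y2 = eval_fps (fps_deriv (fps_deriv (arcsin_fps q 0)))"
  have dy: "(y has_real_derivative y1 x) (at x)" if "\<bar>x\<bar> < 1" for x
    unfolding y_def y1_def using that conv_radius_arcsin_fps by (intro DERIV_eval_fps)
  have dy1: "(y1 has_real_derivative y2 x) (at x)" if "\<bar>x\<bar> < 1" for x
    unfolding y1_def y2_def using that conv_radius_arcsin_fps
    by (intro DERIV_eval_fps fps_deriv_conv_radius_ge_1)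
  define w where "w = (\<lambda>x. sqrt (1 - x\<^sup>2) * y1 x)"
  define r where "r = (\<lambda>x. if q \<ge> 2 then eval_fps (arcsin_fps (q - 2) 0) x else 0)"
  have dw: "(w has_real_derivative r x / sqrt (1 - x\<^sup>2)) (at x)" if "\<bar>x\<bar> < 1" for x
  proof -
    have pos: "1 - x\<^sup>2 > 0" using that by (simp add: abs_square_less_1)
    then have sq: "sqrt (1 - x\<^sup>2) * sqrt (1 - x\<^sup>2) = 1 - x\<^sup>2" by simp
    have "(w has_real_derivative (sqrt (1 - x\<^sup>2) * y2 x - x / sqrt (1 - x\<^sup>2) * y1 x)) (at x)"
      unfolding w_def using pos
      by (auto intro!: derivative_eq_intros dy1 that simp: field_simps)
    also have "sqrt (1 - x\<^sup>2) * y2 x - x / sqrt (1 - x\<^sup>2) * y1 x = ((1 - x\<^sup>2) * y2 x - x * y1 x) / sqrt (1 - x\<^sup>2)"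
      using pos sq by (simp add: field_simps)
    also have "(1 - x\<^sup>2) * y2 x - x * y1 x = r x"
      using eval_arcsin_fps_ode[OF that, of q] by (simp add: y1_def y2_def r_def)
    finally show ?thesis .
  qed
  have darc: "((\<lambda>x. arcsin x ^ Suc n / fact (Suc n)) has_real_derivative arcsin x ^ n / fact n / sqrt (1 - x\<^sup>2)) (at x)"
    if "\<bar>x\<bar> < 1" for x n
  proof -
    have "((\<lambda>x. arcsin x ^ Suc n / fact (Suc n)) has_real_derivative
        real (Suc n) * (inverse (sqrt (1 - x\<^sup>2)) * arcsin x ^ (Suc n - Suc 0)) / fact (Suc n)) (at x)"
      using that by (intro DERIV_cdivide DERIV_power DERIV_arcsin) auto
    also have "real (Suc n) * (inverse (sqrt (1 - x\<^sup>2)) * arcsin x ^ (Suc n - Suc 0)) / fact (Suc n) =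
        arcsin x ^ n / fact n / sqrt (1 - x\<^sup>2)"
      by (simp add: divide_simps)
    finally show ?thesis .
  qed
  have cont: "continuous_on {0..<1} f" if "\<And>x. \<bar>x\<bar> < 1 \<Longrightarrow> (f has_real_derivative f' x) (at x)" for f f' :: "real \<Rightarrow> real"
    by (rule DERIV_continuous_on[OF has_field_derivative_at_within[OF that]]) auto
  have y0: "y 0 = arcsin_coeff q 0" and y10: "y1 0 = arcsin_coeff q 1"
    by (simp_all add: y_def y1_def eval_fps_at_0)
  show ?case
  proof (cases "q = 0")
    case True
    have "arcsin_coeff 0 n = (if n = 0 then 1 else 0)" for n
      by (induction "0::nat" n rule: arcsin_coeff.induct) (auto simp: arcsin_coeff.simps(3))
    then have "arcsin_fps q 0 = 1" unfolding True by (intro fps_ext) simp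
    then show ?thesis by (simp add: True)
  next
    case False
    then obtain n where n: "q = Suc n" using not0_implies_Suc by blast
    have w: "w x = arcsin x ^ n / fact n" if "0 \<le> x" "x < 1" for x
    proof (rule eq_if_same_vector_derivative[where f = w and g = "\<lambda>x. arcsin x ^ n / fact n" and x = x
          and h = "\<lambda>x. r x / sqrt (1 - x\<^sup>2)" and a = 0 and b = 1])
      show "continuous_on {0..<1} w" by (rule cont[OF dw])
      show "w 0 = arcsin 0 ^ n / fact n"
        by (cases n) (auto simp: w_def y10 n)
      show "(w has_vector_derivative r x / sqrt (1 - x\<^sup>2)) (at x)" if "0 < x" "x < 1" for x
        using dw[of x] that by (simp add: has_real_derivative_iff_has_vector_derivative)
      show d: "((\<lambda>a. arcsin a ^ n / fact n) has_vector_derivative r x / sqrt (1 - x\<^sup>2)) (at x)" if "0 < x" "x < 1" for x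
      proof (cases n)
        case (Suc l)
        have "r x = arcsin x ^ l / fact l"
          using less.IH[of l x] that by (simp add: r_def n Suc)
        with darc[of x l] show ?thesis
          using that by (simp add: has_real_derivative_iff_has_vector_derivative Suc)
      qed (simp add: r_def n)
      show "continuous_on {0..<1} (\<lambda>a. arcsin a ^ n / fact n)"
        by (auto intro!: continuous_intros)
    qed (use that in auto)
    show ?thesis unfolding y_def[symmetric]
    proof (rule eq_if_same_vector_derivative[where f = y and g = "\<lambda>x. arcsin x ^ q / fact q" and x = x
          and h = "\<lambda>x. arcsin x ^ n / fact n / sqrt (1 - x\<^sup>2)" and a = 0 and b = 1])
      show "continuous_on {0..<1} y" by (rule cont[OF dy])
      show "y 0 = arcsin 0 ^ q / fact q" by (simp add: y0 n)
      show "(y has_vector_derivative arcsin x ^ n / fact n / sqrt (1 - x\<^sup>2)) (at x)" if "0 < x" "x < 1" for x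
      proof -
        have "1 - x\<^sup>2 > 0" using that by (simp add: abs_square_less_1)
        then have "y1 x = arcsin x ^ n / fact n / sqrt (1 - x\<^sup>2)"
          using w[of x] that by (auto simp: w_def field_simps)
        then show ?thesis
          using dy[of x] that by (simp add: has_real_derivative_iff_has_vector_derivative)
      qed
      show "((\<lambda>a. arcsin a ^ q / fact q) has_vector_derivative arcsin x ^ n / fact n / sqrt (1 - x\<^sup>2)) (at x)"
        if "0 < x" "x < 1" for x
        using darc[of x n] that unfolding n by (simp only: has_real_derivative_iff_has_vector_derivative)
      show "continuous_on {0..<1} (\<lambda>a. arcsin a ^ q / fact q)"
        by (auto intro!: continuous_intros)
    qed (use less.prems in auto)
  qed
qed

subsection \<open>The half-angle parametrisation\<close>

text \<open>For \<open>t = tan (\<theta> / 2)\<close> these are \<open>sin \<theta>\<close>, \<open>cos \<theta>\<close> and \<open>- ln (cos \<theta>)\<close>.\<close>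

definition ha_sin :: "real \<Rightarrow> real" where "ha_sin t = 2 * t / (1 + t\<^sup>2)"
definition ha_cos :: "real \<Rightarrow> real" where "ha_cos t = (1 - t\<^sup>2) / (1 + t\<^sup>2)"
definition ha_logcos :: "real \<Rightarrow> real" where "ha_logcos t = - ln (ha_cos t)"

lemma one_plus_square_pos [simp]: "1 + t\<^sup>2 > (0::real)" "1 + t\<^sup>2 \<noteq> (0::real)"
  using zero_le_power2[of t] by linarith+

lemma ha_sin_cos_square: "ha_cos t ^ 2 = 1 - ha_sin t ^ 2"
proof -
  have "(1 - t\<^sup>2)\<^sup>2 + (2 * t)\<^sup>2 = (1 + t\<^sup>2)\<^sup>2" by (simp add: power2_eq_square algebra_simps)
  then show ?thesis by (simp add: ha_sin_def ha_cos_def power_divide field_simps)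
qed

lemma ha_sin_0 [simp]: "ha_sin 0 = 0" and ha_sin_1 [simp]: "ha_sin 1 = 1"
  and ha_cos_0 [simp]: "ha_cos 0 = 1" and ha_cos_1 [simp]: "ha_cos 1 = 0"
  by (simp_all add: ha_sin_def ha_cos_def)

lemma ha_cos_pos: "\<bar>t\<bar> < 1 \<Longrightarrow> ha_cos t > 0"
  by (simp add: ha_cos_def abs_square_less_1)

lemma ha_cos_nonneg: "\<bar>t\<bar> \<le> 1 \<Longrightarrow> ha_cos t \<ge> 0"
  by (simp add: ha_cos_def abs_square_le_1)

lemma ha_cos_le_1: "ha_cos t \<le> 1"
  by (simp add: ha_cos_def)

lemma ha_sin_nonneg: "0 \<le> t \<Longrightarrow> ha_sin t \<ge> 0"
  by (simp add: ha_sin_def)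

lemma ha_sin_less_1: "\<bar>t\<bar> < 1 \<Longrightarrow> ha_sin t < 1"
proof -
  assume "\<bar>t\<bar> < 1"
  then have "(1 - t)\<^sup>2 > 0" by simp
  then have "2 * t < 1 + t\<^sup>2" by (simp add: power2_eq_square algebra_simps)
  then show ?thesis by (simp add: ha_sin_def divide_less_eq)
qed

lemma ha_logcos_nonneg: "\<bar>t\<bar> < 1 \<Longrightarrow> ha_logcos t \<ge> 0"
  using ha_cos_pos[of t] ha_cos_le_1[of t] by (simp add: ha_logcos_def)

text \<open>Since dt / t = d\<theta> / sin \<theta>, the operator \<open>t * d/dt\<close> is sin
  \<theta> times d/d\<theta>. This derivative and the next three are written as quotients by
  \<open>t\<close> in order to match the Euler operator on series.\<close>

lemma DERIV_ha_sin: "t \<noteq> 0 \<Longrightarrow> (ha_sin has_real_derivative ha_sin t * ha_cos t / t) (at t)"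
  unfolding ha_sin_def[abs_def] ha_cos_def
  by (auto intro!: derivative_eq_intros simp: divide_simps) (simp add: power2_eq_square algebra_simps)

lemma DERIV_ha_cos: "t \<noteq> 0 \<Longrightarrow> (ha_cos has_real_derivative - (ha_sin t)\<^sup>2 / t) (at t)"
  unfolding ha_cos_def[abs_def] ha_sin_def
  by (auto intro!: derivative_eq_intros simp: divide_simps) (simp add: power2_eq_square algebra_simps)

lemma DERIV_ha_logcos:
  "t \<noteq> 0 \<Longrightarrow> \<bar>t\<bar> < 1 \<Longrightarrow> (ha_logcos has_real_derivative (ha_sin t)\<^sup>2 / ha_cos t / t) (at t)"
  unfolding ha_logcos_def[abs_def]
  by (auto intro!: derivative_eq_intros DERIV_ha_cos ha_cos_pos simp: divide_simps)

lemma DERIV_two_arctan: "t \<noteq> 0 \<Longrightarrow> ((\<lambda>t. 2 * arctan t) has_real_derivative ha_sin t / t) (at t)"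
  unfolding ha_sin_def by (auto intro!: derivative_eq_intros simp: divide_simps)

lemma continuous_on_ha_sin: "continuous_on A ha_sin"
  unfolding ha_sin_def[abs_def] by (intro continuous_intros) auto

lemma continuous_on_ha_cos: "continuous_on A ha_cos"
  unfolding ha_cos_def[abs_def] by (intro continuous_intros) auto

lemma continuous_on_ha_logcos: "continuous_on {0..<1} ha_logcos"
  unfolding ha_logcos_def[abs_def]
  by (intro continuous_intros continuous_on_ha_cos) (use ha_cos_pos in \<open>force simp: less_imp_neq[symmetric]\<close>)

lemma arcsin_ha_sin: "\<bar>t\<bar> < 1 \<Longrightarrow> arcsin (ha_sin t) = 2 * arctan t"
proof -
  assume t: "\<bar>t\<bar> < 1"
  have "sin (2 * arctan t) = 2 * t / (sqrt (1 + t\<^sup>2) * sqrt (1 + t\<^sup>2))"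
    by (simp only: sin_double sin_arctan cos_arctan) simp
  also have "sqrt (1 + t\<^sup>2) * sqrt (1 + t\<^sup>2) = 1 + t\<^sup>2" by simp
  finally have "sin (2 * arctan t) = ha_sin t" unfolding ha_sin_def .
  moreover have "- (pi / 4) < arctan t" "arctan t < pi / 4"
    using t arctan_less_iff[of t 1] arctan_less_iff[of "-1" t] by (auto simp: arctan_one arctan_minus)
  ultimately show ?thesis by (intro arcsin_unique) auto
qed

subsection \<open>Evaluation of the polylogarithms\<close>

lemma conv_radius_geom_kernel: "z \<in> quartic_roots \<Longrightarrow> fps_conv_radius (geom_kernel z) \<ge> 1"
  by (intro fps_conv_radius_ge_1_if_bounded) (auto simp: norm_power norm_quartic_root)

lemma fps_sum_conv_radius_ge_1:
  fixes f :: "'b \<Rightarrow> 'a :: {banach, real_normed_div_algebra} fps"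
  shows "(\<And>x. x \<in> A \<Longrightarrow> fps_conv_radius (f x) \<ge> 1) \<Longrightarrow> fps_conv_radius (\<Sum>x\<in>A. f x) \<ge> 1"
  by (induction A rule: infinite_finite_induct) (auto intro!: fps_add_conv_radius_ge_1)

text \<open>The backward direction carries the bound on the radius from an Euler derivative to its
  primitive, which is what the induction over the weight needs.\<close>

lemma fps_conv_radius_euler_iff: "fps_conv_radius f \<ge> 1 \<longleftrightarrow> fps_conv_radius (fps_euler f) \<ge> 1"
proof
  assume "fps_conv_radius f \<ge> 1"
  then show "fps_conv_radius (fps_euler f) \<ge> 1"
    unfolding fps_euler_def by (intro fps_mult_conv_radius_ge_1 fps_deriv_conv_radius_ge_1) auto
next
  assume 1: "fps_conv_radius (fps_euler f) \<ge> 1"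
  show "fps_conv_radius f \<ge> 1"
    unfolding fps_conv_radius_def
  proof (rule conv_radius_geI_ex')
    fix r :: real assume r: "0 < r" "ereal r < 1"
    have "ereal (norm (of_real r :: complex)) < conv_radius (fps_nth (fps_euler f))"
      using norm_less_conv_radius[OF _ 1, of "of_real r"] r by (simp add: fps_conv_radius_def)
    then have "summable (\<lambda>n. norm (fps_euler f $ n * of_real r ^ n))"
      by (rule abs_summable_in_conv_radius)
    \<comment> \<open>The Euler operator kills the constant term, so the comparison starts at index
      \<open>1\<close>.\<close>
    then show "summable (\<lambda>n. f $ n * of_real r ^ n)"
    proof (rule summable_comparison_test'[where N = 1])
      fix n :: nat assume "n \<ge> 1"
      then have "1 * norm (f $ n * of_real r ^ n) \<le> real n * norm (f $ n * of_real r ^ n)"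
        by (intro mult_right_mono) auto
      then show "norm (f $ n * of_real r ^ n) \<le> norm (fps_euler f $ n * of_real r ^ n)"
        by (simp add: norm_mult)
    qed
  qed
qed

lemma conv_radius_polylog4: "f \<in> polylog4 w \<Longrightarrow> fps_conv_radius f \<ge> 1"
proof (induction w arbitrary: f)
  case 0
  then show ?case by auto
next
  case (Suc w)
  obtain f0 fz where f: "f0 \<in> polylog4 w" "\<And>z. z \<in> quartic_roots \<Longrightarrow> fz z \<in> polylog4 w"
    "fps_euler f = f0 + (\<Sum>z\<in>quartic_roots. geom_kernel z * fz z)"
    using Suc.prems by (rule polylog4_SucE) blast
  have "fps_conv_radius (fps_euler f) \<ge> 1"
    unfolding f(3) using f Suc.IH
    by (intro fps_add_conv_radius_ge_1 fps_sum_conv_radius_ge_1 fps_mult_conv_radius_ge_1 conv_radius_geom_kernel) auto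
  then show ?case by (rule fps_conv_radius_euler_iff[THEN iffD2])
qed

lemma of_real_less_conv_radius:
  "0 \<le> t \<Longrightarrow> t < 1 \<Longrightarrow> fps_conv_radius f \<ge> 1 \<Longrightarrow>
     ereal (norm (complex_of_real t)) < fps_conv_radius (f :: complex fps)"
  by (rule norm_less_conv_radius) auto

lemma has_vector_derivative_eval_euler:
  assumes "fps_conv_radius f \<ge> 1" "0 < t" "t < 1"
  shows "((\<lambda>t. eval_fps f (of_real t)) has_vector_derivative eval_fps (fps_euler f) (of_real t) / of_real t) (at t)"
proof -
  note r = of_real_less_conv_radius[OF _ assms(3) assms(1)]
    of_real_less_conv_radius[OF _ assms(3) fps_deriv_conv_radius_ge_1[OF assms(1)]]
  have "(eval_fps f has_field_derivative eval_fps (fps_deriv f) (of_real t)) (at (of_real t))"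
    using r assms by (intro has_field_derivative_eval_fps) auto
  from field_vector_diff_chain_at[OF has_vector_derivative_of_real[OF DERIV_ident] this]
  have "((\<lambda>t. eval_fps f (of_real t)) has_vector_derivative eval_fps (fps_deriv f) (of_real t)) (at t)"
    by (simp add: o_def)
  also have "eval_fps (fps_deriv f) (of_real t) = eval_fps (fps_euler f) (of_real t) / of_real t"
    using r assms by (simp add: fps_euler_def eval_fps_mult)
  finally show ?thesis .
qed

lemma continuous_on_eval_fps_unit:
  fixes f :: "complex fps"
  assumes "fps_conv_radius f \<ge> 1"
  shows "continuous_on {0..<1} (\<lambda>t. eval_fps f (of_real t))"
proof (intro continuous_intros)
  show "complex_of_real ` {0..<1} \<subseteq> eball 0 (fps_conv_radius f)"
    using of_real_less_conv_radius[OF _ _ assms] by (auto simp: in_eball_iff simp del: norm_of_real)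
qed

lemma eval_geom_kernel:
  assumes "z \<in> quartic_roots" "norm t < 1"
  shows "eval_fps (geom_kernel z) t = z * t / (1 - z * t)"
proof -
  have "norm (z * t) < 1" using assms by (simp add: norm_mult norm_quartic_root)
  then have "(\<lambda>n. (z * t) ^ n) sums (1 / (1 - z * t))" by (rule geometric_sums)
  then have "(\<lambda>n. (z * t) ^ n - (if n = 0 then 1 else 0)) sums (1 / (1 - z * t) - 1)"
    by (intro sums_diff sums_single)
  moreover have "(z * t) ^ n - (if n = 0 then 1 else 0) = geom_kernel z $ n * t ^ n" for n
    by (simp add: power_mult_distrib)
  ultimately have "eval_fps (geom_kernel z) t = 1 / (1 - z * t) - 1"
    unfolding eval_fps_def by (simp add: sums_iff)
  also have "\<dots> = z * t / (1 - z * t)"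
  proof -
    have "1 - z * t \<noteq> 0" using \<open>norm (z * t) < 1\<close> by auto
    then show ?thesis by (simp add: field_simps)
  qed
  finally show ?thesis .
qed

lemma eval_geom_kernel_of_real:
  "z \<in> quartic_roots \<Longrightarrow> 0 \<le> t \<Longrightarrow> t < 1 \<Longrightarrow>
     eval_fps (geom_kernel z) (of_real t) = z * of_real t / (1 - z * of_real t)"
  by (rule eval_geom_kernel) auto

lemma quartic_roots_eq: "quartic_roots = {1, -1, \<i>, -\<i>}"
proof -
  have "z \<in> {1, -1, \<i>, -\<i>}" if "z ^ 4 = 1" for z :: complex
  proof -
    have "(z - 1) * (z + 1) * (z - \<i>) * (z + \<i>) = z ^ 4 - 1"
      by (simp add: algebra_simps eval_nat_numeral)
    with that have "z - 1 = 0 \<or> z + 1 = 0 \<or> z - \<i> = 0 \<or> z + \<i> = 0" by simp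
    then show ?thesis by (auto simp: eq_neg_iff_add_eq_0)
  qed
  then show ?thesis by (auto simp: quartic_roots_def)
qed

lemma polylog4_uminus: "f \<in> polylog4 w \<Longrightarrow> - f \<in> polylog4 w"
proof -
  have "fps_const (of_rat (-1)) * f = - f" by (simp add: of_rat_minus flip: fps_const_neg)
  then show "f \<in> polylog4 w \<Longrightarrow> - f \<in> polylog4 w" using polylog4_scale[of f w "-1"] by simp
qed

text \<open>The five slots are the coefficients of \<open>dt / t\<close> and of the forms for the
  roots 1, -1, \<i>, -\<i>, so that membership of a concrete primitive becomes an
  instantiation.\<close>

lemma fps_euler_inv_in_polylog4:
  assumes "f \<in> polylog4 w" "f $ 0 = 0" "a \<in> polylog4 w" "b \<in> polylog4 w" "c \<in> polylog4 w" "d \<in> polylog4 w"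
  shows "fps_euler_inv (f + geom_kernel 1 * a + geom_kernel (-1) * b + geom_kernel \<i> * c + geom_kernel (-\<i>) * d)
    \<in> polylog4 (Suc w)"
proof -
  let ?h = "\<lambda>z. if z = 1 then a else if z = -1 then b else if z = \<i> then c else d"
  show ?thesis
  proof (rule polylog4_SucI[where g = f and h = ?h])
    show "?h z \<in> polylog4 w" for z using assms by auto
    have ne: "1 \<noteq> \<i>" "1 \<noteq> -\<i>" "-1 \<noteq> \<i>" "\<i> \<noteq> -1" "\<i> \<noteq> -\<i>" "\<i> \<noteq> 1" "-\<i> \<noteq> 1" "-\<i> \<noteq> \<i>"
      by (auto simp: complex_eq_iff)
    have "(\<Sum>z\<in>quartic_roots. geom_kernel z * ?h z) =
        geom_kernel 1 * a + geom_kernel (-1) * b + geom_kernel \<i> * c + geom_kernel (-\<i>) * d"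
      unfolding quartic_roots_eq using ne by (simp add: add_ac)
    then show "fps_euler (fps_euler_inv (f + geom_kernel 1 * a + geom_kernel (-1) * b
        + geom_kernel \<i> * c + geom_kernel (-\<i>) * d)) = f + (\<Sum>z\<in>quartic_roots. geom_kernel z * ?h z)"
      using assms(2) by (simp add: fps_euler_euler_inv add_ac)
  qed (use assms in auto)
qed

section \<open>Angle, logarithm and arcsine powers as level-four polylogarithms\<close>

text \<open>The series of \<i> \<theta>, since the two kernels differ by \<i> sin \<theta>. The
  factor \<i> stays inside because removing it would take a coefficient that is not
  rational.\<close>

definition angle_fps :: "complex fps" where
  "angle_fps = fps_euler_inv (geom_kernel \<i> - geom_kernel (-\<i>))"

text \<open>The series of - ln cos \<theta>, whose Euler derivative is sin^2 \<theta> / cos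
  \<theta>. The roots 1 and -1 contribute \<open>2 t^2 / (1 - t^2)\<close>, and the roots \<i> and
  -\<i> contribute cos \<theta> - 1, which is subtracted.\<close>

definition logcos_fps :: "complex fps" where
  "logcos_fps = fps_euler_inv (geom_kernel 1 + geom_kernel (-1) - (geom_kernel \<i> + geom_kernel (-\<i>)))"

text \<open>The bracket is cos \<theta>, and cos \<theta> dt / t = cot \<theta> d\<theta>: one more
  integration for each \<open>j\<close>.\<close>

primrec arcsin_power_fps :: "nat \<Rightarrow> nat \<Rightarrow> complex fps" where
  "arcsin_power_fps q 0 = fps_const (1 / fact q) * angle_fps ^ q"
| "arcsin_power_fps q (Suc j) =
     fps_euler_inv (arcsin_power_fps q j * (1 + (geom_kernel \<i> + geom_kernel (-\<i>))))"

lemma angle_fps_in_polylog4: "angle_fps \<in> polylog4 1"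
  using fps_euler_inv_in_polylog4[of 0 0 0 0 1 "-1"] polylog4_one polylog4_uminus[OF polylog4_one]
  by (simp add: angle_fps_def del: polylog4.simps)

lemma logcos_fps_in_polylog4: "logcos_fps \<in> polylog4 1"
  using fps_euler_inv_in_polylog4[of 0 0 1 1 "-1" "-1"] polylog4_one polylog4_uminus[OF polylog4_one]
  by (simp add: logcos_fps_def algebra_simps del: polylog4.simps)

lemma polylog4_divide_fact:
  "f \<in> polylog4 w \<Longrightarrow> fps_const (1 / fact n) * f \<in> polylog4 w"
proof -
  have "(of_rat (1 / of_nat (fact n)) :: complex) = 1 / fact n"
    unfolding of_rat_divide of_rat_of_nat_eq of_rat_1 by simp
  then show "f \<in> polylog4 w \<Longrightarrow> fps_const (1 / fact n) * f \<in> polylog4 w"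
    using polylog4_scale[of f w "1 / of_nat (fact n)"] by simp
qed

lemma arcsin_power_fps_nth_0: "q \<ge> 1 \<Longrightarrow> arcsin_power_fps q j $ 0 = 0"
  by (cases j) (auto simp: angle_fps_def fps_power_zeroth)

lemma arcsin_power_fps_in_polylog4: "q \<ge> 1 \<Longrightarrow> arcsin_power_fps q j \<in> polylog4 (q + j)"
proof (induction j)
  case 0
  show ?case
    using polylog4_divide_fact[OF polylog4_power[OF angle_fps_in_polylog4, of q]]
    by (simp del: polylog4.simps)
next
  case (Suc j)
  define f where "f = arcsin_power_fps q j"
  have "fps_euler_inv (f + geom_kernel 1 * 0 + geom_kernel (-1) * 0 + geom_kernel \<i> * f + geom_kernel (-\<i>) * f)
    \<in> polylog4 (Suc (q + j))"
    using Suc arcsin_power_fps_nth_0[of q j] unfolding f_def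
    by (intro fps_euler_inv_in_polylog4) (auto simp del: polylog4.simps)
  then show ?case
    by (simp add: f_def algebra_simps del: polylog4.simps)
qed

lemma one_pm_i_nonzero: "1 - \<i> * of_real t \<noteq> 0" "1 + \<i> * of_real t \<noteq> 0"
  by (auto simp: complex_eq_iff)

lemma eval_geom_kernel_i_diff:
  assumes "0 \<le> t" "t < 1"
  shows "eval_fps (geom_kernel \<i> - geom_kernel (-\<i>)) (of_real t) = \<i> * of_real (ha_sin t)"
proof -
  define u v where "u = 1 - \<i> * of_real t" and "v = 1 + \<i> * of_real t"
  have uv: "u \<noteq> 0" "v \<noteq> 0" "u * v = of_real (1 + t\<^sup>2)" "u + v = 2"
    using one_pm_i_nonzero[of t] by (simp_all add: u_def v_def algebra_simps power2_eq_square)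
  have "eval_fps (geom_kernel \<i> - geom_kernel (-\<i>)) (of_real t) = \<i> * of_real t / u + \<i> * of_real t / v"
    using assms by (subst eval_fps_diff)
      (simp_all add: eval_geom_kernel_of_real u_def v_def conv_radius_geom_kernel of_real_less_conv_radius del: norm_of_real)
  also have "\<dots> = \<i> * of_real t * (u + v) / (u * v)"
    using uv(1,2) by (simp add: field_simps)
  also have "\<dots> = \<i> * of_real (ha_sin t)"
    unfolding uv by (simp add: ha_sin_def)
  finally show ?thesis .
qed

lemma eval_geom_kernel_i_add:
  assumes "0 \<le> t" "t < 1"
  shows "eval_fps (geom_kernel \<i> + geom_kernel (-\<i>)) (of_real t) = of_real (ha_cos t - 1)"
proof -
  define u v where "u = 1 - \<i> * of_real t" and "v = 1 + \<i> * of_real t"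
  have uv: "u \<noteq> 0" "v \<noteq> 0" "u * v = of_real (1 + t\<^sup>2)" "v - u = 2 * \<i> * of_real t"
    using one_pm_i_nonzero[of t] by (simp_all add: u_def v_def algebra_simps power2_eq_square)
  have "eval_fps (geom_kernel \<i> + geom_kernel (-\<i>)) (of_real t) = \<i> * of_real t / u - \<i> * of_real t / v"
    using assms by (subst eval_fps_add)
      (simp_all add: eval_geom_kernel_of_real u_def v_def conv_radius_geom_kernel of_real_less_conv_radius del: norm_of_real)
  also have "\<dots> = \<i> * of_real t * (v - u) / (u * v)"
    using uv(1,2) by (simp add: field_simps)
  also have "\<dots> = of_real (- 2 * t\<^sup>2 / (1 + t\<^sup>2))"
  proof -
    have "\<i> * of_real t * (2 * \<i> * of_real t) = of_real (- 2 * t\<^sup>2)"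
      by (simp add: complex_eq_iff power2_eq_square)
    then show ?thesis unfolding uv by (simp only: of_real_divide)
  qed
  also have "- 2 * t\<^sup>2 / (1 + t\<^sup>2) = ha_cos t - 1"
    by (simp add: ha_cos_def field_simps)
  finally show ?thesis .
qed

lemma eval_geom_kernel_log:
  assumes "0 \<le> t" "t < 1"
  shows "eval_fps (geom_kernel 1 + geom_kernel (-1) - (geom_kernel \<i> + geom_kernel (-\<i>))) (of_real t) =
    of_real ((ha_sin t)\<^sup>2 / ha_cos t)"
proof -
  have r: "ereal (norm (complex_of_real t)) < fps_conv_radius (geom_kernel z)" if "z \<in> quartic_roots" for z
    using assms that by (intro of_real_less_conv_radius conv_radius_geom_kernel)
  have r2: "ereal (norm (complex_of_real t)) < fps_conv_radius (geom_kernel y + geom_kernel z)"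
    if "y \<in> quartic_roots" "z \<in> quartic_roots" for y z
    using assms that by (intro of_real_less_conv_radius fps_add_conv_radius_ge_1 conv_radius_geom_kernel)
  have "eval_fps (geom_kernel 1 + geom_kernel (-1)) (of_real t) =
      of_real t / (1 - of_real t) - of_real t / (1 + of_real t)"
    using assms r by (subst eval_fps_add) (simp_all add: eval_geom_kernel_of_real del: norm_of_real)
  also have "\<dots> = of_real (t / (1 - t) - t / (1 + t))" by simp
  finally have "eval_fps (geom_kernel 1 + geom_kernel (-1) - (geom_kernel \<i> + geom_kernel (-\<i>))) (of_real t) =
      of_real (t / (1 - t) - t / (1 + t) - (ha_cos t - 1))"
    using assms r2 eval_geom_kernel_i_add[of t]
    by (subst eval_fps_diff) (simp_all del: norm_of_real)
  also have "t / (1 - t) - t / (1 + t) = 2 * t\<^sup>2 / (1 - t\<^sup>2)"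
    using assms by (simp add: field_simps power2_eq_square)
  also have "2 * t\<^sup>2 / (1 - t\<^sup>2) - (ha_cos t - 1) = (ha_sin t)\<^sup>2 / ha_cos t"
  proof -
    have "1 - t\<^sup>2 > 0" "1 + t\<^sup>2 > 0" using assms by (auto simp: abs_square_less_1)
    then show ?thesis unfolding ha_cos_def ha_sin_def
      by (simp add: divide_simps) (simp add: power2_eq_square algebra_simps)
  qed
  finally show ?thesis .
qed

lemma eval_angle_fps:
  assumes "0 \<le> t" "t < 1"
  shows "eval_fps angle_fps (of_real t) = \<i> * of_real (2 * arctan t)"
proof (rule eq_if_same_vector_derivative[where f = "\<lambda>t. eval_fps angle_fps (of_real t)"
      and g = "\<lambda>t. \<i> * of_real (2 * arctan t)" and h = "\<lambda>t. \<i> * of_real (ha_sin t / t)" and a = 0 and b = 1 and x = t])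
  have r: "fps_conv_radius angle_fps \<ge> 1" by (rule conv_radius_polylog4[OF angle_fps_in_polylog4])
  then show "continuous_on {0..<1} (\<lambda>t. eval_fps angle_fps (of_real t))"
    by (rule continuous_on_eval_fps_unit)
  show "continuous_on {0..<1} (\<lambda>t. \<i> * of_real (2 * arctan t))"
    by (intro continuous_intros)
  show "eval_fps angle_fps (of_real 0) = \<i> * of_real (2 * arctan 0)"
    by (simp add: eval_fps_at_0 angle_fps_def)
  show "((\<lambda>t. eval_fps angle_fps (of_real t)) has_vector_derivative \<i> * of_real (ha_sin x / x)) (at x)"
    if "0 < x" "x < 1" for x
    using has_vector_derivative_eval_euler[OF r that] eval_geom_kernel_i_diff[of x] that
    by (simp add: angle_fps_def fps_euler_euler_inv)
  show "((\<lambda>t. \<i> * of_real (2 * arctan t)) has_vector_derivative \<i> * of_real (ha_sin x / x)) (at x)"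
    if "0 < x" "x < 1" for x
    using that by (intro has_vector_derivative_mult_right has_vector_derivative_of_real DERIV_two_arctan) auto
qed (use assms in auto)

lemma eval_logcos_fps:
  assumes "0 \<le> t" "t < 1"
  shows "eval_fps logcos_fps (of_real t) = of_real (ha_logcos t)"
proof (rule eq_if_same_vector_derivative[where f = "\<lambda>t. eval_fps logcos_fps (of_real t)"
      and g = "\<lambda>t. of_real (ha_logcos t)" and h = "\<lambda>t. of_real ((ha_sin t)\<^sup>2 / ha_cos t / t)" and a = 0 and b = 1 and x = t])
  have r: "fps_conv_radius logcos_fps \<ge> 1" by (rule conv_radius_polylog4[OF logcos_fps_in_polylog4])
  then show "continuous_on {0..<1} (\<lambda>t. eval_fps logcos_fps (of_real t))"
    by (rule continuous_on_eval_fps_unit)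
  show "continuous_on {0..<1} (\<lambda>t. complex_of_real (ha_logcos t))"
    by (intro continuous_intros continuous_on_ha_logcos)
  show "eval_fps logcos_fps (of_real 0) = of_real (ha_logcos 0)"
    by (simp add: eval_fps_at_0 logcos_fps_def ha_logcos_def)
  show "((\<lambda>t. eval_fps logcos_fps (of_real t)) has_vector_derivative of_real ((ha_sin x)\<^sup>2 / ha_cos x / x)) (at x)"
    if "0 < x" "x < 1" for x
    using has_vector_derivative_eval_euler[OF r that] eval_geom_kernel_log[of x] that
    by (simp add: logcos_fps_def fps_euler_euler_inv)
  show "((\<lambda>t. of_real (ha_logcos t)) has_vector_derivative of_real ((ha_sin x)\<^sup>2 / ha_cos x / x)) (at x)"
    if "0 < x" "x < 1" for x
    using that by (intro has_vector_derivative_of_real DERIV_ha_logcos) auto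
qed (use assms in auto)

definition arcsin_power_fun :: "nat \<Rightarrow> nat \<Rightarrow> real \<Rightarrow> real" where
  "arcsin_power_fun q j t = eval_fps (arcsin_fps q j) (ha_sin t)"

lemma continuous_on_arcsin_power_fun: "continuous_on {0..<1} (arcsin_power_fun q j)"
  unfolding arcsin_power_fun_def[abs_def]
proof (intro continuous_on_eval_fps' continuous_on_ha_sin)
  have "ereal (norm (ha_sin t)) < fps_conv_radius (arcsin_fps q j)" if "0 \<le> t" "t < 1" for t
    using that ha_sin_nonneg[of t] ha_sin_less_1[of t]
    by (intro norm_less_conv_radius conv_radius_arcsin_fps) auto
  then show "ha_sin ` {0..<1} \<subseteq> eball 0 (fps_conv_radius (arcsin_fps q j))"
    by (auto simp: in_eball_iff dist_norm)
qed

text \<open>For \<open>q \<ge> 1\<close> the constant coefficient is zero, so nothing is lost in the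
  division by \<open>n\<close> and \<open>x * d/dx\<close> undoes it.\<close>

lemma DERIV_arcsin_power_fun:
  assumes "q \<ge> 1" "0 < t" "t < 1"
  shows "(arcsin_power_fun q (Suc j) has_real_derivative arcsin_power_fun q j t * ha_cos t / t) (at t)"
proof -
  define x where "x = ha_sin t"
  have x: "0 < x" "x < 1" using assms ha_sin_less_1[of t] by (auto simp: x_def ha_sin_def)
  have r: "fps_conv_radius (fps_deriv (arcsin_fps q (Suc j))) \<ge> 1"
    by (intro fps_deriv_conv_radius_ge_1 conv_radius_arcsin_fps)
  have "fps_X * fps_deriv (arcsin_fps q (Suc j)) = arcsin_fps q j"
  proof (rule fps_ext)
    fix n show "(fps_X * fps_deriv (arcsin_fps q (Suc j))) $ n = arcsin_fps q j $ n"
      using assms(1) by (cases n) auto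
  qed
  then have "x * eval_fps (fps_deriv (arcsin_fps q (Suc j))) x = arcsin_power_fun q j t"
    using eval_fps_mult[of x fps_X "fps_deriv (arcsin_fps q (Suc j))"] norm_less_conv_radius[OF _ r, of x] x
    by (simp add: arcsin_power_fun_def x_def)
  then have eq: "eval_fps (fps_deriv (arcsin_fps q (Suc j))) x * (x * ha_cos t / t) =
      arcsin_power_fun q j t * ha_cos t / t"
    by (metis (no_types, lifting) mult.assoc mult.commute times_divide_eq_right)
  have "(eval_fps (arcsin_fps q (Suc j)) has_real_derivative
      eval_fps (fps_deriv (arcsin_fps q (Suc j))) x) (at (ha_sin t))"
    using x conv_radius_arcsin_fps unfolding x_def by (intro DERIV_eval_fps) auto
  from DERIV_chain2[OF this DERIV_ha_sin[of t]]
  have "((\<lambda>t. eval_fps (arcsin_fps q (Suc j)) (ha_sin t)) has_real_derivative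
      eval_fps (fps_deriv (arcsin_fps q (Suc j))) x * (x * ha_cos t / t)) (at t)"
    using assms(2) by (simp only: x_def)
  then show ?thesis
    unfolding eq unfolding arcsin_power_fun_def[of q "Suc j", abs_def] .
qed

text \<open>Both sides vanish at \<open>0\<close> and arise from their predecessors by the same
  integration against cos \<theta> dt / t; \<open>\<i> ^ q\<close> is the power of the factor
  carried by the angle series.\<close>

lemma eval_arcsin_power_fps:
  assumes "q \<ge> 1" "0 \<le> t" "t < 1"
  shows "eval_fps (arcsin_power_fps q j) (of_real t) = \<i> ^ q * of_real (arcsin_power_fun q j t)"
  using assms(2,3)
proof (induction j arbitrary: t)
  case 0
  have "fps_conv_radius angle_fps \<ge> 1" by (rule conv_radius_polylog4[OF angle_fps_in_polylog4])
  note r = of_real_less_conv_radius[OF 0 this]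
    of_real_less_conv_radius[OF 0 order_trans[OF this fps_conv_radius_power]]
  have "eval_fps (arcsin_power_fps q 0) (of_real t) = 1 / fact q * (\<i> * of_real (2 * arctan t)) ^ q"
    using r 0 by (simp add: eval_fps_mult eval_fps_power eval_angle_fps del: norm_of_real)
  also have "\<dots> = \<i> ^ q * of_real (arcsin (ha_sin t) ^ q / fact q)"
    using 0 by (simp add: arcsin_ha_sin power_mult_distrib)
  also have "arcsin (ha_sin t) ^ q / fact q = arcsin_power_fun q 0 t"
    using 0 ha_sin_nonneg[of t] ha_sin_less_1[of t] by (simp add: eval_arcsin_fps_0 arcsin_power_fun_def)
  finally show ?case .
next
  case (Suc j)
  let ?h = "\<lambda>t. \<i> ^ q * of_real (arcsin_power_fun q j t * ha_cos t / t)"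
  show ?case
  proof (rule eq_if_same_vector_derivative[where f = "\<lambda>t. eval_fps (arcsin_power_fps q (Suc j)) (of_real t)"
      and g = "\<lambda>t. \<i> ^ q * of_real (arcsin_power_fun q (Suc j) t)" and h = ?h and a = 0 and b = 1 and x = t])
    have r: "fps_conv_radius (arcsin_power_fps q i) \<ge> 1" for i
      by (rule conv_radius_polylog4[OF arcsin_power_fps_in_polylog4[OF assms(1)]])
    then show "continuous_on {0..<1} (\<lambda>t. eval_fps (arcsin_power_fps q (Suc j)) (of_real t))"
      by (rule continuous_on_eval_fps_unit)
    show "continuous_on {0..<1} (\<lambda>t. \<i> ^ q * of_real (arcsin_power_fun q (Suc j) t))"
      by (intro continuous_intros continuous_on_arcsin_power_fun)
    show "eval_fps (arcsin_power_fps q (Suc j)) (of_real 0) = \<i> ^ q * of_real (arcsin_power_fun q (Suc j) 0)"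
      using assms(1) by (simp add: eval_fps_at_0 arcsin_power_fun_def)
    show "((\<lambda>t. eval_fps (arcsin_power_fps q (Suc j)) (of_real t)) has_vector_derivative ?h x) (at x)"
      if "0 < x" "x < 1" for x
    proof -
      have k: "fps_conv_radius (geom_kernel \<i> + geom_kernel (-\<i>)) \<ge> 1"
        by (intro fps_add_conv_radius_ge_1 conv_radius_geom_kernel) auto
      have k1: "fps_conv_radius (1 + (geom_kernel \<i> + geom_kernel (-\<i>))) \<ge> 1"
        by (rule fps_add_conv_radius_ge_1[OF _ k]) simp
      have x: "0 \<le> x" using that by simp
      have "eval_fps (fps_euler (arcsin_power_fps q (Suc j))) (of_real x) =
          eval_fps (arcsin_power_fps q j * (1 + (geom_kernel \<i> + geom_kernel (-\<i>)))) (of_real x)"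
        using arcsin_power_fps_nth_0[OF assms(1), of j] by (simp add: fps_euler_euler_inv)
      also have "\<dots> = eval_fps (arcsin_power_fps q j) (of_real x) * of_real (ha_cos x)"
        using of_real_less_conv_radius[OF x that(2) r[of j]] of_real_less_conv_radius[OF x that(2) k]
          of_real_less_conv_radius[OF x that(2) k1] eval_geom_kernel_i_add[OF x that(2)]
        by (simp add: eval_fps_mult eval_fps_add[of _ 1] del: norm_of_real)
      also have "\<dots> = \<i> ^ q * of_real (arcsin_power_fun q j x * ha_cos x)"
        using Suc.IH[OF x that(2)] by simp
      finally show ?thesis
        using has_vector_derivative_eval_euler[OF r that, of "Suc j"] by (simp del: arcsin_power_fps.simps)
    qed
    show "((\<lambda>t. \<i> ^ q * of_real (arcsin_power_fun q (Suc j) t)) has_vector_derivative ?h x) (at x)"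
      if "0 < x" "x < 1" for x
      using that assms(1)
      by (intro has_vector_derivative_mult_right has_vector_derivative_of_real DERIV_arcsin_power_fun)
  qed (use Suc.prems in auto)
qed

subsection \<open>Moments\<close>

text \<open>Only \<open>x = 0\<close> is delicate: with \<open>u = - ln x\<close> the function is
  \<open>u ^ k / exp u\<close>, which tends to 0. This controls cos \<theta> times a power of - ln
  cos \<theta> at the endpoint \<open>t = 1\<close>.\<close>

lemma continuous_on_mult_log_power: "continuous_on {0..1} (\<lambda>x::real. x * (- ln x) ^ k)"
proof (subst continuous_on_def, intro ballI)
  fix x :: real assume x: "x \<in> {0..1}"
  show "((\<lambda>x. x * (- ln x) ^ k) \<longlongrightarrow> x * (- ln x) ^ k) (at x within {0..1})"
  proof (cases "x = 0")
    case False
    then show ?thesis using x by (auto intro!: tendsto_intros)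
  next
    case True
    have "filterlim (\<lambda>x::real. - ln x) at_top (at_right 0)"
      using ln_at_0 by (simp add: filterlim_uminus_at_bot)
    from filterlim_compose[OF tendsto_power_div_exp_0[of k] this]
    have "((\<lambda>x::real. (- ln x) ^ k / exp (- ln x)) \<longlongrightarrow> 0) (at_right 0)" .
    moreover have "eventually (\<lambda>x::real. (- ln x) ^ k / exp (- ln x) = x * (- ln x) ^ k) (at_right 0)"
      by (auto simp: eventually_at_filter exp_minus field_simps)
    ultimately have "((\<lambda>x::real. x * (- ln x) ^ k) \<longlongrightarrow> 0) (at_right 0)"
      by (rule Lim_transform_eventually)
    moreover have "at (0::real) within {0..1} = at_right 0"
      by (rule at_within_Icc_at_right) simp
    ultimately show ?thesis by (simp add: True)
  qed
qed

lemma continuous_on_cos_logcos_power: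
  "continuous_on {0..1} (\<lambda>t. ha_sin t ^ N * ha_cos t * (ha_logcos t ^ k / fact k))"
proof -
  have "continuous_on {0..1} (\<lambda>t. ha_cos t * (- ln (ha_cos t)) ^ k)"
    by (rule continuous_on_compose2[OF continuous_on_mult_log_power continuous_on_ha_cos])
       (simp add: image_subset_iff ha_cos_nonneg ha_cos_le_1)
  then have "continuous_on {0..1} (\<lambda>t. ha_sin t ^ N * (ha_cos t * (- ln (ha_cos t)) ^ k) * (1 / fact k))"
    by (intro continuous_on_mult_right continuous_on_mult[OF continuous_on_power[OF continuous_on_ha_sin]])
  then show ?thesis by (simp add: ha_logcos_def mult.assoc)
qed

text \<open>Integration by parts in differential form. The factor \<open>ha_cos\<close> tames the
  logarithm at \<open>t = 1\<close>, and cos^2 \<theta> = 1 - sin^2 \<theta> leaves only moment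
  integrands of orders \<open>N\<close> and \<open>N + 2\<close>.\<close>

lemma DERIV_moment:
  assumes "0 < t" "t < 1"
  shows "((\<lambda>t. ha_sin t ^ N * ha_cos t * (ha_logcos t ^ k / fact k)) has_real_derivative
     (real N * (ha_sin t ^ N * (ha_logcos t ^ k / fact k) / t)
      - real (N + 1) * (ha_sin t ^ (N + 2) * (ha_logcos t ^ k / fact k) / t)
      + (if k = 0 then 0 else ha_sin t ^ (N + 2) * (ha_logcos t ^ (k - 1) / fact (k - 1)) / t))) (at t)"
proof -
  define s c L where "s = ha_sin t" and "c = ha_cos t" and "L = ha_logcos t"
  have c: "c > 0" using ha_cos_pos[of t] assms by (simp add: c_def)
  have c2: "c * c = 1 - s * s" using ha_sin_cos_square[of t] by (simp add: c_def s_def power2_eq_square)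
  have 1: "((\<lambda>t. ha_sin t ^ N) has_real_derivative real N * s ^ N * c / t) (at t)"
    using DERIV_power[OF DERIV_ha_sin[of t], of N] assms
    by (cases N) (simp_all add: s_def c_def mult_ac)
  have 2: "(ha_cos has_real_derivative - (s * s) / t) (at t)"
    using DERIV_ha_cos[of t] assms by (simp add: s_def power2_eq_square)
  define M where "M = (if k = 0 then 0 else L ^ (k - 1) / fact (k - 1))"
  have 3: "((\<lambda>t. ha_logcos t ^ k / fact k) has_real_derivative M * (s * s / c / t)) (at t)"
  proof (rule DERIV_cong[OF DERIV_cdivide[OF DERIV_power[OF DERIV_ha_logcos[of t], of k], of "fact k"]])
    show "real k * ((ha_sin t)\<^sup>2 / ha_cos t / t * ha_logcos t ^ (k - Suc 0)) / fact k = M * (s * s / c / t)"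
      by (cases k) (simp_all add: s_def c_def M_def L_def power2_eq_square mult_ac del: of_nat_Suc)
  qed (use assms in auto)
  have "((\<lambda>t. ha_sin t ^ N * ha_cos t * (ha_logcos t ^ k / fact k)) has_real_derivative
     (real N * s ^ N * c / t * c + - (s * s) / t * s ^ N) * (L ^ k / fact k) + M * (s * s / c / t) * (s ^ N * c)) (at t)"
    using DERIV_mult[OF DERIV_mult[OF 1 2] 3] by (simp add: s_def c_def L_def)
  also have "M * (s * s / c / t) * (s ^ N * c) = M * s ^ (N + 2) / t"
    using c by (simp add: power_add power2_eq_square)
  also have "real N * s ^ N * c / t * c + - (s * s) / t * s ^ N = (real N * s ^ N * (c * c) - s * s * s ^ N) / t"
    by (simp add: diff_divide_distrib)
  also have "\<dots> = (real N * s ^ N - real (N + 1) * s ^ (N + 2)) / t"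
    unfolding c2 by (simp add: algebra_simps power_add power2_eq_square)
  finally show ?thesis
    unfolding s_def[symmetric] L_def[symmetric] M_def
    by (rule DERIV_cong) (auto simp: algebra_simps diff_divide_distrib add_divide_distrib)
qed

definition has_moment :: "nat \<Rightarrow> nat \<Rightarrow> real \<Rightarrow> bool" where
  "has_moment N k I \<longleftrightarrow> ((\<lambda>t. ha_sin t ^ N * (ha_logcos t ^ k / fact k) / t) has_integral I) {0..1}"

text \<open>The boundary terms vanish except at \<open>t = 0\<close> for \<open>N = k = 0\<close>,
  where the primitive is 1. This exception is the source of the even moments.\<close>

lemma has_integral_moment:
  "((\<lambda>t. real N * (ha_sin t ^ N * (ha_logcos t ^ k / fact k) / t)
      - real (N + 1) * (ha_sin t ^ (N + 2) * (ha_logcos t ^ k / fact k) / t)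
      + (if k = 0 then 0 else ha_sin t ^ (N + 2) * (ha_logcos t ^ (k - 1) / fact (k - 1)) / t))
    has_integral (if N = 0 \<and> k = 0 then -1 else 0)) {0..1}"
proof -
  let ?F = "\<lambda>t. ha_sin t ^ N * ha_cos t * (ha_logcos t ^ k / fact k)"
  have "?F 1 - ?F 0 = (if N = 0 \<and> k = 0 then -1 else 0)"
    by (auto simp: power_0_left ha_logcos_def)
  moreover have "((\<lambda>t. real N * (ha_sin t ^ N * (ha_logcos t ^ k / fact k) / t)
      - real (N + 1) * (ha_sin t ^ (N + 2) * (ha_logcos t ^ k / fact k) / t)
      + (if k = 0 then 0 else ha_sin t ^ (N + 2) * (ha_logcos t ^ (k - 1) / fact (k - 1)) / t))
    has_integral ?F 1 - ?F 0) {0..1}"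
    by (rule fundamental_theorem_of_calculus_interior[OF _ continuous_on_cos_logcos_power], simp,
        subst has_real_derivative_iff_has_vector_derivative[symmetric], rule DERIV_moment) auto
  ultimately show ?thesis by simp
qed

text \<open>The preceding relation solved for the moment of order \<open>N + 2\<close>. The moment
  of order \<open>N\<close> enters with the factor \<open>N\<close>, so it is asked for only when
  \<open>N \<ge> 1\<close>; \<open>b\<close> is the moment with one logarithm fewer, and zero if
  there is none. The last assumption excludes the exceptional boundary term.\<close>

lemma has_moment_step:
  assumes "N \<ge> 1 \<Longrightarrow> has_moment N k a" "k \<ge> 1 \<Longrightarrow> has_moment (N + 2) (k - 1) b" "k = 0 \<Longrightarrow> b = 0" "N \<ge> 1 \<or> k \<ge> 1"
  shows "has_moment (N + 2) k ((real N * a + b) / (real N + 1))"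
proof -
  let ?A = "\<lambda>t. real N * (ha_sin t ^ N * (ha_logcos t ^ k / fact k) / t)"
  let ?B = "\<lambda>t. if k = 0 then 0 else ha_sin t ^ (N + 2) * (ha_logcos t ^ (k - 1) / fact (k - 1)) / t"
  let ?C = "\<lambda>t. ha_sin t ^ (N + 2) * (ha_logcos t ^ k / fact k) / t"
  have A: "(?A has_integral real N * a) {0..1}"
  proof (cases "N = 0")
    case False
    then have "has_moment N k a" using assms(1) by simp
    from has_integral_mult_right[OF this[unfolded has_moment_def], of "real N"] show ?thesis .
  qed simp
  have B: "(?B has_integral b) {0..1}"
    using assms(2,3) by (cases "k = 0") (auto simp: has_moment_def)
  have D: "((\<lambda>t. ?A t - real (N + 1) * ?C t + ?B t) has_integral 0) {0..1}"
    using has_integral_moment[of N k] assms(4) by (auto split: if_splits)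
  \<comment> \<open>Integrability of \<open>?C\<close> is not known beforehand, so \<open>?C\<close>
    is written as a combination of functions whose integrals are known.\<close>
  have "((\<lambda>t. (?A t + ?B t - (?A t - real (N + 1) * ?C t + ?B t)) * (1 / (real N + 1)))
     has_integral (real N * a + b - 0) * (1 / (real N + 1))) {0..1}"
    by (intro has_integral_mult_left has_integral_diff has_integral_add A B D)
  moreover have cancel: "(x + y - (x - real (N + 1) * z + y)) * (1 / (real N + 1)) = z" for x y z :: real
    by (simp add: field_simps)
  have "(?A t + ?B t - (?A t - real (N + 1) * ?C t + ?B t)) * (1 / (real N + 1)) = ?C t" for t
    by (rule cancel)
  ultimately show ?thesis by (simp add: has_moment_def)
qed

text \<open>The boundary value -1 gives the start. For \<open>N = 0\<close> the recursion then
  passes the value on from \<open>k\<close> to \<open>k + 1\<close> unchanged.\<close>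

lemma has_moment_2: "has_moment 2 k 1"
proof (induction k)
  case 0
  have "((\<lambda>t. - (- (ha_sin t ^ 2 / t))) has_integral - (-1)) {0..1}"
    using has_integral_neg[OF has_integral_moment[of 0 0]] by (simp add: numeral_2_eq_2)
  then show ?case by (simp add: has_moment_def)
next
  case (Suc k)
  then show ?case using has_moment_step[of 0 "Suc k" 0 1] by (simp add: numeral_2_eq_2)
qed

lemma has_moment_1: "has_moment 1 0 (pi / 2)"
proof -
  have "((\<lambda>t. ha_sin t / t) has_integral 2 * arctan 1 - 2 * arctan 0) {0..1}"
    by (rule fundamental_theorem_of_calculus_interior)
       (auto intro!: continuous_intros DERIV_two_arctan simp flip: has_real_derivative_iff_has_vector_derivative)
  then show ?thesis by (simp add: has_moment_def arctan_one)
qed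

section \<open>Central binomial ratios and Wallis' integral\<close>

lemma central_binomial_Suc:
  "real (Suc n) * real ((2 * Suc n) choose Suc n) = 2 * (2 * real n + 1) * real ((2 * n) choose n)"
proof -
  have cb: "real ((2 * m) choose m) * (fact m * fact m) = fact (2 * m)" for m
  proof -
    have "m \<le> 2 * m" "2 * m - m = m" by auto
    with binomial_fact[of m "2 * m", where 'a = real] show ?thesis by simp
  qed
  define B B' where "B = real ((2 * n) choose n)" and "B' = real ((2 * Suc n) choose Suc n)"
  have "(real (Suc n) * B') * (real (Suc n) * (fact n * fact n)) = B' * (fact (Suc n) * fact (Suc n))"
    by (simp only: fact_Suc mult_ac)
  also have "\<dots> = fact (2 * Suc n)" unfolding B'_def by (rule cb)
  also have "\<dots> = real (2 * n + 2) * (real (2 * n + 1) * fact (2 * n))"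
    by (simp add: algebra_simps)
  also have "fact (2 * n) = B * (fact n * fact n)" unfolding B_def by (rule cb[symmetric])
  also have "real (2 * n + 2) * (real (2 * n + 1) * (B * (fact n * fact n))) =
      (2 * (2 * real n + 1) * B) * (real (Suc n) * (fact n * fact n))"
    by (simp add: algebra_simps)
  finally have "real (Suc n) * B' = 2 * (2 * real n + 1) * B"
    by (subst (asm) mult_right_cancel) auto
  then show ?thesis unfolding B_def B'_def .
qed

definition central_ratio :: "nat \<Rightarrow> real" where
  "central_ratio n = 1 / 4 ^ n * real ((2 * n) choose n)"

lemma central_ratio_pos: "central_ratio n > 0"
  by (simp add: central_ratio_def)

lemma central_ratio_0 [simp]: "central_ratio 0 = 1"
  by (simp add: central_ratio_def)

lemma central_ratio_Suc: "central_ratio (Suc n) = central_ratio n * (2 * real n + 1) / (2 * real n + 2)"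
proof -
  define B B' where "B = real ((2 * n) choose n)" and "B' = real ((2 * Suc n) choose Suc n)"
  have "(real n + 1) * B' = 2 * (2 * real n + 1) * B"
    using central_binomial_Suc[of n] unfolding B_def B'_def by (simp only: of_nat_Suc add.commute[of 1])
  then have "B' = 2 * (2 * real n + 1) * B / (real n + 1)" by (simp add: field_simps)
  then show ?thesis
    unfolding central_ratio_def B_def[symmetric] B'_def[symmetric]
    by (simp add: divide_simps) (simp add: algebra_simps)
qed

text \<open>One sine cancels against d\<theta> / sin \<theta>, which leaves Wallis' integral of sin
  \<theta> to the power \<open>2 * n\<close>.\<close>

lemma has_moment_odd: "has_moment (2 * n + 1) 0 (pi / 2 * central_ratio n)"
proof (induction n)
  case 0
  then show ?case using has_moment_1 by simp
next
  case (Suc n)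
  from has_moment_step[of "2 * n + 1" 0 _ 0, OF Suc]
  have "has_moment (2 * n + 1 + 2) 0 ((real (2 * n + 1) * (pi / 2 * central_ratio n) + 0) / (real (2 * n + 1) + 1))"
    by simp
  then show ?case by (simp add: central_ratio_Suc mult_ac add_ac)
qed

section \<open>Recursions for truncated sums, and the even moments\<close>

lemma weak_indices_0: "weak_indices N 0 = {[]}"
  by (auto simp: weak_indices_def)

text \<open>If the largest entry is \<open>Suc n\<close>, the tail may reach \<open>Suc n\<close>
  again. So the recursion for \<open>t_star_sum\<close> has upper bound \<open>Suc n\<close> in its
  last term, where \<open>t_sum\<close> has \<open>n\<close>.\<close>

lemma weak_indices_Suc_Suc:
  "weak_indices (Suc n) (Suc s) = weak_indices n (Suc s) \<union> (#) (Suc n) ` weak_indices (Suc n) s"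
proof (intro equalityI subsetI)
  fix xs assume "xs \<in> weak_indices (Suc n) (Suc s)"
  then obtain y ys where ys: "xs = y # ys" "length ys = s" "y \<in> {1..Suc n}"
    "\<forall>x\<in>set ys. x \<le> y \<and> x \<ge> 1" "sorted_wrt (\<ge>) ys"
    unfolding weak_indices_def by (cases xs) (auto simp: subset_iff)
  show "xs \<in> weak_indices n (Suc s) \<union> (#) (Suc n) ` weak_indices (Suc n) s"
  proof (cases "y = Suc n")
    case True
    then have "ys \<in> weak_indices (Suc n) s" using ys by (auto simp: weak_indices_def)
    with True ys show ?thesis by blast
  next
    case False
    with ys have "xs \<in> weak_indices n (Suc s)" by (force simp: weak_indices_def)
    then show ?thesis by blast
  qed
next
  fix xs assume "xs \<in> weak_indices n (Suc s) \<union> (#) (Suc n) ` weak_indices (Suc n) s"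
  then show "xs \<in> weak_indices (Suc n) (Suc s)"
  proof
    assume "xs \<in> (#) (Suc n) ` weak_indices (Suc n) s"
    then show ?thesis by (auto simp: weak_indices_def subset_iff)
  next
    assume "xs \<in> weak_indices n (Suc s)"
    then show ?thesis by (fastforce simp: weak_indices_def)
  qed
qed

lemma t_star_sum_Nil [simp]: "t_star_sum n [] = 1"
  by (simp add: t_star_sum_def weak_indices_0)

lemma t_star_sum_0_Cons [simp]: "t_star_sum 0 (a # as) = 0"
proof -
  have "weak_indices 0 (Suc s) = {}" for s by (auto simp: weak_indices_def)
  then show ?thesis by (simp add: t_star_sum_def)
qed

lemma t_star_sum_Suc:
  "t_star_sum (Suc n) (a # as) = t_star_sum n (a # as) + t_star_sum (Suc n) as / (2 * real n + 1) ^ a"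
proof -
  have "weak_indices n (Suc (length as)) \<inter> (#) (Suc n) ` weak_indices (Suc n) (length as) = {}"
    by (auto simp: weak_indices_def)
  then show ?thesis
    unfolding t_star_sum_def length_Cons weak_indices_Suc_Suc
    by (subst sum.union_disjoint)
       (simp_all add: sum.reindex prod.lessThan_Suc_shift sum_divide_distrib add_ac del: prod.lessThan_Suc)
qed

lemma t_sum_Nil [simp]: "t_sum n [] = 1" and zeta_sum_Nil [simp]: "zeta_sum n [] = 1"
  by (simp_all add: t_sum_def zeta_sum_def strict_indices_0)

lemma t_sum_0_Cons [simp]: "t_sum 0 (a # as) = 0" and zeta_sum_0_Cons [simp]: "zeta_sum 0 (a # as) = 0"
  by (simp_all add: t_sum_def zeta_sum_def strict_indices_Suc)

lemma t_sum_Suc: "t_sum (Suc n) (a # as) = t_sum n (a # as) + t_sum n as / (2 * real n + 1) ^ a"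
  by (simp add: t_sum_def sum_strict_indices_Suc prod.lessThan_Suc_shift sum_divide_distrib add_ac
      del: prod.lessThan_Suc)

lemma zeta_sum_Suc: "zeta_sum (Suc n) (a # as) = zeta_sum n (a # as) + zeta_sum n as / (real n + 1) ^ a"
  by (simp add: zeta_sum_def sum_strict_indices_Suc prod.lessThan_Suc_shift sum_divide_distrib add_ac
      del: prod.lessThan_Suc)

text \<open>In the moment recursion the term with one logarithm fewer already has the new order
  \<open>2 * n + 2\<close>. This matches the recursion of weakly decreasing sums, and so the star
  version appears.\<close>

lemma has_moment_even:
  "n \<ge> 1 \<Longrightarrow> has_moment (2 * n) k (1 / central_ratio n / (2 * real n) * t_star_sum n (replicate k 1))"
proof (induction k arbitrary: n)
  case 0
  from 0 show ?case
  proof (induction n rule: nat_induct_at_least)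
    case base
    then show ?case using has_moment_2[of 0] by (simp add: central_ratio_Suc[of 0, simplified])
  next
    case (Suc n)
    from has_moment_step[of "2 * n" 0 _ 0, OF Suc.IH] Suc.hyps
    have "has_moment (2 * n + 2) 0 ((real (2 * n) * (1 / central_ratio n / (2 * real n)) + 0) / (real (2 * n) + 1))"
      by simp
    moreover have "(real (2 * n) * (1 / central_ratio n / (2 * real n)) + 0) / (real (2 * n) + 1) =
        1 / central_ratio (Suc n) / (2 * real (Suc n))"
      using Suc.hyps central_ratio_pos[of n] by (simp add: central_ratio_Suc divide_simps)
    ultimately show ?case by simp
  qed
next
  case (Suc k)
  note IH_k = Suc.IH
  from Suc.prems show ?case
  proof (induction n rule: nat_induct_at_least)
    case base
    have "t_star_sum 1 (replicate k 1) = 1" for k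
      by (induction k) (use t_star_sum_Suc[of 0 1] in auto)
    from this[of "Suc k"] show ?case
      using has_moment_2[of "Suc k"] by (simp add: central_ratio_Suc[of 0, simplified])
  next
    case (Suc n)
    let ?a = "1 / central_ratio n / (2 * real n) * t_star_sum n (replicate (Suc k) 1)"
    let ?b = "1 / central_ratio (Suc n) / (2 * real (Suc n)) * t_star_sum (Suc n) (replicate k 1)"
    have "has_moment (2 * n + 2) (Suc k) ((real (2 * n) * ?a + ?b) / (real (2 * n) + 1))"
      by (rule has_moment_step) (use Suc.IH Suc.hyps IH_k[of "Suc n"] in auto)
    moreover have "(real (2 * n) * ?a + ?b) / (real (2 * n) + 1) =
        1 / central_ratio (Suc n) / (2 * real (Suc n)) * t_star_sum (Suc n) (replicate (Suc k) 1)"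
    proof -
      define r e T U where "r = 1 / central_ratio n / (2 * real n)" and "e = 1 / central_ratio (Suc n) / (2 * real (Suc n))"
        and "T = t_star_sum n (replicate (Suc k) 1)" and "U = t_star_sum (Suc n) (replicate k 1)"
      \<comment> \<open>The prefactor obeys the moment recursion without logarithms; dividing it out
        leaves the recursion of the star sums.\<close>
      have eq: "real (2 * n) * r = e * (2 * real n + 1)"
        using Suc.hyps central_ratio_pos[of n] unfolding e_def r_def by (simp add: central_ratio_Suc divide_simps)
      have "real (2 * n) * (r * T) = e * (2 * real n + 1) * T"
        by (simp only: mult.assoc[symmetric] eq)
      then have "(real (2 * n) * (r * T) + e * U) / (real (2 * n) + 1) =
          (e * (2 * real n + 1) * T + e * U) / (2 * real n + 1)"
        by (simp only: of_nat_mult of_nat_numeral)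
      also have "\<dots> = e * (T + U / (2 * real n + 1))"
        by (simp add: divide_simps) (simp add: algebra_simps)
      also have "T + U / (2 * real n + 1) = t_star_sum (Suc n) (replicate (Suc k) 1)"
        by (simp add: T_def U_def t_star_sum_Suc)
      finally show ?thesis unfolding r_def e_def T_def U_def .
    qed
    ultimately show ?case by simp
  qed
qed

subsection \<open>The arcsine coefficients as multiple harmonic sums\<close>

lemma arcsin_coeff_parity: "odd (q + n) \<Longrightarrow> arcsin_coeff q n = 0"
  by (induction q n rule: arcsin_coeff.induct) (auto simp: arcsin_coeff.simps(3) intro!: odd_pos)

text \<open>With \<open>x = 2 * n + 1\<close>, the part of the recursion that keeps \<open>q\<close>
  carries the sums with top index at most \<open>n\<close>, and the part that lowers
  \<open>q\<close> by two adds those with the new top index, weighted by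
  \<open>1 / x ^ 2\<close>.\<close>

lemma arcsin_coeff_odd:
  "arcsin_coeff (2 * p + 1) (2 * n + 1) = central_ratio n * t_sum n (replicate p 2) / (2 * real n + 1)"
proof (induction n arbitrary: p)
  case 0
  show ?case by (cases p) auto
next
  case (Suc n)
  define R where "R = (if p = 0 then 0 else central_ratio n * t_sum n (replicate (p - 1) 2) / (2 * real n + 1))"
  define x where "x = 2 * real n + 1"
  have x: "x > 0" by (simp add: x_def)
  have "(if 2 * p + 1 \<ge> 2 then arcsin_coeff (2 * p + 1 - 2) (2 * n + 1) else 0) = R"
    using Suc.IH[of "p - 1"] by (cases p) (auto simp: R_def)
  then have "(x + 1) * (x + 2) * arcsin_coeff (2 * p + 1) (Suc (Suc (2 * n + 1))) =
      x ^ 2 * (central_ratio n * t_sum n (replicate p 2) / x) + R"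
    using arcsin_coeff_rec[of "2 * n + 1" "2 * p + 1"] Suc.IH[of p]
    by (simp add: x_def add_ac)
  also have "\<dots> = x * central_ratio n * t_sum (Suc n) (replicate p 2)"
  proof (cases p)
    case 0
    then show ?thesis using x by (simp add: R_def power2_eq_square)
  next
    case (Suc p')
    define T U where "T = t_sum n (2 # replicate p' 2)" and "U = t_sum n (replicate p' 2)"
    have "x ^ 2 * (central_ratio n * T / x) + central_ratio n * U / x = x * central_ratio n * (T + U / x ^ 2)"
      using x by (simp add: power2_eq_square field_simps)
    then show ?thesis by (simp add: Suc R_def t_sum_Suc x_def T_def U_def)
  qed
  also have "\<dots> = (x + 1) * central_ratio (Suc n) * t_sum (Suc n) (replicate p 2)"
  proof -
    have "(x + 1) * central_ratio (Suc n) = x * central_ratio n"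
      by (simp add: central_ratio_Suc x_def field_simps)
    then show ?thesis by simp
  qed
  finally have "(x + 1) * ((x + 2) * arcsin_coeff (2 * p + 1) (Suc (Suc (2 * n + 1)))) =
      (x + 1) * (central_ratio (Suc n) * t_sum (Suc n) (replicate p 2))"
    by (simp only: mult.assoc)
  then have "(x + 2) * arcsin_coeff (2 * p + 1) (Suc (Suc (2 * n + 1))) =
      central_ratio (Suc n) * t_sum (Suc n) (replicate p 2)"
    using x by simp
  then have "arcsin_coeff (2 * p + 1) (Suc (Suc (2 * n + 1))) =
      central_ratio (Suc n) * t_sum (Suc n) (replicate p 2) / (x + 2)"
    using x by (simp add: eq_divide_eq mult.commute)
  then show ?case by (simp add: x_def add_ac)
qed

text \<open>The mechanism of the odd case, now with even integers: every entry contributes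
  \<open>1 / (2 * i) ^ 2\<close>, and the fours are collected in front. The largest index
  \<open>n + 1\<close> is split off, so the remaining sum stops at \<open>n\<close>.\<close>

lemma arcsin_coeff_even:
  "arcsin_coeff (2 * Suc p) (2 * Suc n) =
     1 / central_ratio (Suc n) * zeta_sum n (replicate p 2) / (4 ^ Suc p * (real n + 1) ^ 2)"
proof (induction n arbitrary: p)
  case 0
  have "2 * Suc 0 = Suc (Suc 0)" by simp
  then have a: "arcsin_coeff (2 * Suc p) (2 * Suc 0) = (if p = 0 then 1 / 2 else 0)"
    by (cases p) (auto simp only: arcsin_coeff.simps, auto)
  have c: "central_ratio (Suc 0) = 1 / 2" by (simp add: central_ratio_Suc)
  show ?case unfolding a c by (cases p) simp_all
next
  case (Suc n)
  define x where "x = real n + 1"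
  have x: "x > 0" by (simp add: x_def)
  define r where "r = 1 / central_ratio (Suc n)"
  have r: "1 / central_ratio (Suc (Suc n)) = r * (2 * x + 2) / (2 * x + 1)"
    using central_ratio_pos[of "Suc n"] by (simp add: central_ratio_Suc[of "Suc n"] r_def x_def field_simps)
  define R where "R = (if p = 0 then 0 else r * zeta_sum n (replicate (p - 1) 2) / (4 ^ p * x ^ 2))"
  have "arcsin_coeff (2 * Suc p - 2) (2 * Suc n) = R"
  proof (cases p)
    case 0
    have "arcsin_coeff 0 n = (if n = 0 then 1 else 0)" for n
      by (induction "0::nat" n rule: arcsin_coeff.induct) (auto simp: arcsin_coeff.simps(3))
    then show ?thesis by (simp add: 0 R_def)
  next
    case (Suc p')
    then have "2 * Suc p - 2 = 2 * Suc p'" by simp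
    then show ?thesis using Suc.IH[of p'] by (simp only: Suc R_def r_def x_def) simp
  qed
  then have "(2 * x + 1) * (2 * x + 2) * arcsin_coeff (2 * Suc p) (Suc (Suc (2 * Suc n))) =
      (2 * x) ^ 2 * (r * zeta_sum n (replicate p 2) / (4 ^ Suc p * x ^ 2)) + R"
    using arcsin_coeff_rec[of "2 * Suc n" "2 * Suc p"] Suc.IH[of p]
    by (simp add: x_def r_def algebra_simps)
  also have "\<dots> = r * zeta_sum (Suc n) (replicate p 2) / 4 ^ p"
  proof (cases p)
    case 0
    then show ?thesis using x by (simp add: R_def power2_eq_square)
  next
    case (Suc p')
    define T U where "T = zeta_sum n (2 # replicate p' 2)" and "U = zeta_sum n (replicate p' 2)"
    have "(2 * x) ^ 2 * (r * T / (4 ^ Suc p * x ^ 2)) + r * U / (4 ^ p * x ^ 2) = r * (T + U / x ^ 2) / 4 ^ p"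
      using x by (simp add: power2_eq_square field_simps)
    then show ?thesis by (simp add: Suc R_def zeta_sum_Suc x_def T_def U_def)
  qed
  finally have "(2 * x + 1) * (2 * x + 2) * arcsin_coeff (2 * Suc p) (Suc (Suc (2 * Suc n))) =
      r * zeta_sum (Suc n) (replicate p 2) / 4 ^ p" .
  moreover have "(2 * x + 1) * (2 * x + 2) \<noteq> 0" using x by simp
  ultimately have "arcsin_coeff (2 * Suc p) (Suc (Suc (2 * Suc n))) =
      r * zeta_sum (Suc n) (replicate p 2) / 4 ^ p / ((2 * x + 1) * (2 * x + 2))"
    by (metis nonzero_mult_div_cancel_left)
  also have "\<dots> = (r * (2 * x + 2) / (2 * x + 1)) * zeta_sum (Suc n) (replicate p 2) / (4 ^ Suc p * (x + 1) ^ 2)"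
    using x by (simp add: power2_eq_square divide_simps) (simp add: algebra_simps)
  finally show ?case unfolding r[symmetric] by (simp add: x_def add_ac)
qed

subsection \<open>Summation under the integral sign\<close>

text \<open>The primitive against \<open>dt / t\<close> has absolutely summable coefficients and is
  thus continuous up to \<open>t = 1\<close>. The fundamental theorem applies even where
  \<open>f\<close> is unbounded near \<open>1\<close>.\<close>

lemma polylog4_has_integral:
  assumes "f \<in> polylog4 (Suc w)"
    and "\<And>t. 0 < t \<Longrightarrow> t < 1 \<Longrightarrow> eval_fps f (of_real t) = g t"
  shows "((\<lambda>t. g t / of_real t) has_integral (\<Sum>n. f $ n / of_nat n)) {0..1}"
proof -
  define h where "h = (\<lambda>t. eval_fps (fps_euler_inv f) (complex_of_real t))"
  have f0: "f $ 0 = 0" using assms(1) by auto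
  have "fps_conv_radius (fps_euler (fps_euler_inv f)) \<ge> 1"
    unfolding fps_euler_euler_inv[OF f0] by (rule conv_radius_polylog4[OF assms(1)])
  then have r: "fps_conv_radius (fps_euler_inv f) \<ge> 1"
    by (rule fps_conv_radius_euler_iff[THEN iffD2])
  have "uniform_limit {0..1} (\<lambda>n t. \<Sum>i<n. fps_euler_inv f $ i * of_real t ^ i)
     (\<lambda>t::real. \<Sum>i. fps_euler_inv f $ i * of_real t ^ i) sequentially"
  proof (rule Weierstrass_m_test)
    show "summable (\<lambda>n. norm (f $ n / of_nat n))" by (rule polylog4_Suc_value(1)[OF assms(1)])
    show "norm (fps_euler_inv f $ n * of_real t ^ n) \<le> norm (f $ n / of_nat n)" if "t \<in> {0..1}" for n t
    proof -
      have "norm (fps_euler_inv f $ n * of_real t ^ n) = norm (f $ n / of_nat n) * t ^ n"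
        using that by (simp add: norm_mult norm_power norm_divide)
      also have "\<dots> \<le> norm (f $ n / of_nat n) * 1"
        using that by (intro mult_left_mono power_le_one) auto
      finally show ?thesis by simp
    qed
  qed
  then have "continuous_on {0..1} (\<lambda>t::real. \<Sum>i. fps_euler_inv f $ i * of_real t ^ i)"
    by (rule uniform_limit_theorem[rotated], simp)
       (intro always_eventually allI continuous_intros)
  then have cont: "continuous_on {0..1} h" unfolding h_def eval_fps_def .
  have "((\<lambda>t. g t / of_real t) has_integral (h 1 - h 0)) {0..1}"
  proof (rule fundamental_theorem_of_calculus_interior[OF _ cont])
    show "(h has_vector_derivative g t / of_real t) (at t)" if "t \<in> {0<..<1}" for t
      using has_vector_derivative_eval_euler[OF r, of t] assms(2)[of t] that
      unfolding h_def fps_euler_euler_inv[OF f0] by simp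
  qed simp
  moreover have "h 1 = (\<Sum>n. f $ n / of_nat n)" "h 0 = 0"
    by (simp_all add: h_def eval_fps_at_0) (simp add: eval_fps_def)
  ultimately show ?thesis by simp
qed

text \<open>One integral is evaluated twice, as a polylogarithm value and term by term. Moments are
  required only at nonzero coefficients, since for a given \<open>q\<close> only one parity of
  \<open>n\<close> occurs.\<close>

lemma arcsin_moment_sums:
  assumes "q \<ge> 1" and moment: "\<And>n. arcsin_coeff q n \<noteq> 0 \<Longrightarrow> has_moment n k (\<mu> n)"
  shows "\<exists>S. ((\<lambda>n. arcsin_coeff q n / real n ^ j * \<mu> n) sums S) \<and>
     \<i> ^ q * complex_of_real S \<in> CMZV4 (q + j + k + 1)"
proof -
  define f where "f = arcsin_power_fps q j * (fps_const (1 / fact k) * logcos_fps ^ k)"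
  define w where "w = q + j + k - 1"
  have "f \<in> polylog4 (q + j + 1 * k)"
    unfolding f_def
    by (intro polylog4_mult arcsin_power_fps_in_polylog4[OF assms(1)] polylog4_divide_fact
        polylog4_power logcos_fps_in_polylog4)
  then have f: "f \<in> polylog4 (Suc w)" using assms(1) by (simp add: w_def del: polylog4.simps)
  define W where "W = (\<lambda>t. ha_logcos t ^ k / fact k / t)"
  define F where "F = (\<lambda>t. arcsin_power_fun q j t * W t)"
  define v where "v = (\<Sum>n. f $ n / of_nat n)"
  have eval_f: "eval_fps f (of_real t) =
      \<i> ^ q * of_real (arcsin_power_fun q j t) * of_real (ha_logcos t ^ k / fact k)" if "0 < t" "t < 1" for t
  proof -
    have t: "0 \<le> t" using that by simp
    note r = conv_radius_polylog4[OF arcsin_power_fps_in_polylog4[OF assms(1), of j]]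
      conv_radius_polylog4[OF logcos_fps_in_polylog4]
      conv_radius_polylog4[OF polylog4_power[OF logcos_fps_in_polylog4, of k]]
      conv_radius_polylog4[OF polylog4_divide_fact[OF polylog4_power[OF logcos_fps_in_polylog4, of k], of k]]
    note r' = r[THEN of_real_less_conv_radius[OF t that(2)]]
    show ?thesis
      using r' eval_arcsin_power_fps[OF assms(1) t that(2), of j] eval_logcos_fps[OF t that(2)]
      unfolding f_def by (simp add: eval_fps_mult eval_fps_power del: norm_of_real)
  qed
  \<comment> \<open>The factor \<open>(-\<i>) ^ q\<close> cancels \<open>\<i> ^ q\<close> and makes
    the integrand real.\<close>
  from polylog4_has_integral[OF f eval_f]
  have "((\<lambda>t. (-\<i>) ^ q * (\<i> ^ q * of_real (arcsin_power_fun q j t) * of_real (ha_logcos t ^ k / fact k) / of_real t))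
      has_integral (-\<i>) ^ q * v) {0..1}"
    unfolding v_def by (intro has_integral_mult_right)
  moreover have "(-\<i>) ^ q * (\<i> ^ q * of_real (arcsin_power_fun q j t) * of_real (ha_logcos t ^ k / fact k) / of_real t)
      = complex_of_real (F t)" for t
  proof -
    have "(-\<i>) ^ q * \<i> ^ q = 1" by (simp flip: power_mult_distrib)
    then show ?thesis by (simp add: F_def W_def mult.assoc[symmetric])
  qed
  ultimately have cF: "((\<lambda>t. complex_of_real (F t)) has_integral (-\<i>) ^ q * v) {0..1}" by simp
  define S where "S = Re ((-\<i>) ^ q * v)"
  have rF: "(F has_integral S) {0..1}"
    using has_integral_linear[OF cF bounded_linear_Re] by (simp add: o_def S_def)
  have "((\<lambda>t. complex_of_real (F t)) has_integral of_real S) {0..1}"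
    using has_integral_linear[OF rF bounded_linear_of_real] by (simp add: o_def)
  then have "of_real S = (-\<i>) ^ q * v" using cF by (rule has_integral_unique)
  then have "\<i> ^ q * of_real S = v" by (simp add: mult.assoc[symmetric] flip: power_mult_distrib)
  moreover have "v \<in> CMZV4 (Suc (Suc w))" unfolding v_def by (rule polylog4_Suc_value(2)[OF f])
  ultimately have v: "\<i> ^ q * of_real S \<in> CMZV4 (q + j + k + 1)" using assms(1) by (simp add: w_def)
  define a where "a = (\<lambda>n. arcsin_coeff q n / real n ^ j)"
  have a0: "a n \<ge> 0" for n using arcsin_coeff_bounds[of q n] by (simp add: a_def)
  \<comment> \<open>The endpoint \<open>t = 1\<close> is left out, since there the sine is 1 and
    lies on the boundary of the disc of convergence.\<close>
  have part: "((\<lambda>t. \<Sum>n<N. a n * (ha_sin t ^ n * W t)) has_integral (\<Sum>n<N. a n * \<mu> n)) {0<..<1}" for N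
  proof (intro has_integral_sum)
    fix n
    show "((\<lambda>t. a n * (ha_sin t ^ n * W t)) has_integral a n * \<mu> n) {0<..<1}"
    proof (cases "arcsin_coeff q n = 0")
      case False
      then have "((\<lambda>t. ha_sin t ^ n * W t) has_integral \<mu> n) {0<..<1}"
        using moment[of n] by (simp add: has_moment_def W_def has_integral_Icc_iff_Ioo)
      then show ?thesis by (rule has_integral_mult_right)
    qed (simp add: a_def)
  qed simp
  have W0: "W t \<ge> 0" if "t \<in> {0<..<1}" for t
    using ha_logcos_nonneg[of t] that by (simp add: W_def)
  have sumsF: "(\<lambda>n. a n * (ha_sin t ^ n * W t)) sums F t" if "t \<in> {0<..<1}" for t
  proof -
    have "ereal (norm (ha_sin t)) < fps_conv_radius (arcsin_fps q j)"
      using that ha_sin_nonneg[of t] ha_sin_less_1[of t]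
      by (intro norm_less_conv_radius conv_radius_arcsin_fps) auto
    from sums_mult2[OF sums_eval_fps[OF this], of "W t"] show ?thesis
      by (simp add: F_def a_def arcsin_power_fun_def mult.assoc)
  qed
  have rF': "(F has_integral S) {0<..<1}" using rF by (simp add: has_integral_Icc_iff_Ioo)
  \<comment> \<open>All terms are nonnegative, so the limit \<open>F\<close> itself dominates the
    partial sums.\<close>
  have "(\<lambda>N. integral {0<..<1} (\<lambda>t. \<Sum>n<N. a n * (ha_sin t ^ n * W t))) \<longlonglongrightarrow> integral {0<..<1} F"
  proof (rule dominated_convergence(2))
    show "(\<lambda>t. \<Sum>n<N. a n * (ha_sin t ^ n * W t)) integrable_on {0<..<1}" for N
      using part by blast
    show "F integrable_on {0<..<1}" using rF' by blast
    show "norm (\<Sum>n<N. a n * (ha_sin t ^ n * W t)) \<le> F t" if "t \<in> {0<..<1}" for N t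
    proof -
      have nn: "a n * (ha_sin t ^ n * W t) \<ge> 0" for n
        using a0 W0[OF that] ha_sin_nonneg[of t] that by (intro mult_nonneg_nonneg zero_le_power) auto
      have "(\<Sum>n<N. a n * (ha_sin t ^ n * W t)) \<le> F t"
        unfolding sums_unique[OF sumsF[OF that]]
        by (intro sum_le_suminf sums_summable[OF sumsF[OF that]] nn) auto
      then show ?thesis using nn by (simp add: sum_nonneg)
    qed
    show "(\<lambda>N. \<Sum>n<N. a n * (ha_sin t ^ n * W t)) \<longlonglongrightarrow> F t" if "t \<in> {0<..<1}" for t
      using sumsF[OF that] by (simp add: sums_def)
  qed
  then have "(\<lambda>n. a n * \<mu> n) sums S"
    unfolding sums_def integral_unique[OF rF'] integral_unique[OF part] .
  with v show ?thesis unfolding a_def by blast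
qed

lemma has_moment_nonneg: "has_moment N k I \<Longrightarrow> I \<ge> 0"
  unfolding has_moment_def has_integral_Icc_iff_Ioo
  by (rule has_integral_nonneg)
     (auto intro!: mult_nonneg_nonneg divide_nonneg_nonneg zero_le_power ha_sin_nonneg ha_logcos_nonneg)

text \<open>Nonnegativity makes the order of summation irrelevant, and vanishing coefficients allow
  the restriction to the one parity class parametrised by \<open>h\<close>.\<close>

lemma arcsin_moment_has_sum:
  assumes "q \<ge> 1" and moment: "\<And>n. n \<in> h ` A \<Longrightarrow> has_moment n k (\<mu> n)"
    and "inj_on h A" and zero: "\<And>n. n \<notin> h ` A \<Longrightarrow> arcsin_coeff q n = 0"
  shows "\<exists>S. ((\<lambda>i. arcsin_coeff q (h i) / real (h i) ^ j * \<mu> (h i)) has_sum S) A \<and>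
     \<i> ^ q * complex_of_real S \<in> CMZV4 (q + j + k + 1)"
proof -
  have m: "has_moment n k (\<mu> n)" if "arcsin_coeff q n \<noteq> 0" for n
    using moment zero that by blast
  from arcsin_moment_sums[OF assms(1) m, of j] obtain S where
    S: "(\<lambda>n. arcsin_coeff q n / real n ^ j * \<mu> n) sums S" "\<i> ^ q * complex_of_real S \<in> CMZV4 (q + j + k + 1)"
    by blast
  define g where "g = (\<lambda>n. arcsin_coeff q n / real n ^ j * \<mu> n)"
  have "g n \<ge> 0" for n
    using arcsin_coeff_bounds[of q n] has_moment_nonneg[OF m, of n]
    by (cases "arcsin_coeff q n = 0") (auto simp: g_def)
  then have "(g has_sum S) UNIV"
    using S(1) unfolding g_def[symmetric] by (intro norm_summable_imp_has_sum) (auto simp: sums_iff)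
  also have "?this \<longleftrightarrow> (g has_sum S) (h ` A)"
    by (rule has_sum_cong_neutral) (auto simp: zero g_def)
  finally have "((\<lambda>n. arcsin_coeff q n / real n ^ j * \<mu> n) has_sum S) (h ` A)"
    unfolding g_def .
  then have "((\<lambda>i. arcsin_coeff q (h i) / real (h i) ^ j * \<mu> (h i)) has_sum S) A"
    by (simp add: has_sum_reindex[OF assms(3)] o_def)
  with S(2) show ?thesis by blast
qed

section \<open>The two series\<close>

lemma CMZV4_scale: "x \<in> CMZV4 w \<Longrightarrow> of_rat r * x \<in> CMZV4 w"
  unfolding CMZV4_def by (rule rat_complex.span_scale)

text \<open>No strictly decreasing list of \<open>p\<close> indices fits into \<open>{1..n}\<close>.
  This and its zeta analogue account for the lower limits of the two series.\<close>

lemma t_sum_eq_0: "n < p \<Longrightarrow> t_sum n (replicate p 2) = 0"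
proof (induction n arbitrary: p)
  case 0
  then show ?case by (cases p) auto
next
  case (Suc n)
  from Suc.IH[of p] Suc.IH[of "p - 1"] Suc.prems show ?case by (cases p) (auto simp: t_sum_Suc)
qed

lemma zeta_sum_eq_0: "n < p \<Longrightarrow> zeta_sum n (replicate p 2) = 0"
proof (induction n arbitrary: p)
  case 0
  then show ?case by (cases p) auto
next
  case (Suc n)
  from Suc.IH[of p] Suc.IH[of "p - 1"] Suc.prems show ?case by (cases p) (auto simp: zeta_sum_Suc)
qed

text \<open>One central binomial factor is in the arcsine coefficient of order
  \<open>2 * p - 1\<close>, the other in Wallis' moment, whose pi / 2 is divided out.\<close>

lemma central_binomial_t_series:
  assumes "p \<ge> 1" and "m \<ge> 1"
  shows "\<exists>S :: real.
        ((\<lambda>n. (1 / 4 ^ n * real ((2 * n) choose n)) ^ 2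
              * t_sum n (replicate (p - 1) 2) / (2 * real n + 1) ^ m) has_sum S) {p - 1..}
        \<and> complex_of_real S \<in> (\<lambda>x. \<i> / complex_of_real pi * x) ` CMZV4 (2 * p + m - 1)"
proof -
  define p' m' where "p' = p - 1" and "m' = m - 1"
  have pm: "p = Suc p'" "m = Suc m'" using assms by (auto simp: p'_def m'_def)
  define h :: "nat \<Rightarrow> nat" where "h = (\<lambda>n. 2 * n + 1)"
  define \<mu> where "\<mu> = (\<lambda>N. pi / 2 * central_ratio (N div 2))"
  have "\<exists>S. ((\<lambda>i. arcsin_coeff (2 * p' + 1) (h i) / real (h i) ^ m' * \<mu> (h i)) has_sum S) {p'..} \<and>
     \<i> ^ (2 * p' + 1) * complex_of_real S \<in> CMZV4 (2 * p' + 1 + m' + 0 + 1)"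
  proof (rule arcsin_moment_has_sum)
    show "has_moment n 0 (\<mu> n)" if "n \<in> h ` {p'..}" for n
      using that has_moment_odd by (auto simp: h_def \<mu>_def)
    show "inj_on h {p'..}" by (auto simp: inj_on_def h_def)
    show "arcsin_coeff (2 * p' + 1) n = 0" if "n \<notin> h ` {p'..}" for n
    proof (cases "even n")
      case True
      then show ?thesis by (intro arcsin_coeff_parity) auto
    next
      case False
      then obtain i where i: "n = 2 * i + 1" by (rule oddE)
      then have "i < p'" using that by (force simp: h_def)
      then show ?thesis unfolding i arcsin_coeff_odd by (simp add: t_sum_eq_0)
    qed
  qed simp
  then obtain S where S: "((\<lambda>i. arcsin_coeff (2 * p' + 1) (h i) / real (h i) ^ m' * \<mu> (h i)) has_sum S) {p'..}"
    "\<i> ^ (2 * p' + 1) * complex_of_real S \<in> CMZV4 (2 * p + m - 1)"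
    by (auto simp: pm)
  have "((\<lambda>i. 2 / pi * (arcsin_coeff (2 * p' + 1) (h i) / real (h i) ^ m' * \<mu> (h i))) has_sum 2 / pi * S) {p'..}"
    by (rule has_sum_cmult_right[OF S(1)])
  moreover have "2 / pi * (arcsin_coeff (2 * p' + 1) (h i) / real (h i) ^ m' * \<mu> (h i)) =
      (1 / 4 ^ i * real ((2 * i) choose i)) ^ 2 * t_sum i (replicate (p - 1) 2) / (2 * real i + 1) ^ m" for i
    unfolding h_def arcsin_coeff_odd central_ratio_def[symmetric] \<mu>_def pm
    by (simp add: power2_eq_square add_ac)
  ultimately have 1: "((\<lambda>n. (1 / 4 ^ n * real ((2 * n) choose n)) ^ 2
      * t_sum n (replicate (p - 1) 2) / (2 * real n + 1) ^ m) has_sum 2 / pi * S) {p - 1..}"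
    by (simp only: p'_def)
  \<comment> \<open>The sign is forced by
    \<open>\<i> * \<i> ^ (2 * p' + 1) = - ((- 1) ^ p')\<close>, and the 2 comes from 2 / pi.\<close>
  have "of_rat (- 2 * (- 1) ^ p') * (\<i> ^ (2 * p' + 1) * complex_of_real S) \<in> CMZV4 (2 * p + m - 1)"
    by (rule CMZV4_scale[OF S(2)])
  moreover have "complex_of_real (2 / pi * S) =
      \<i> / complex_of_real pi * (of_rat (- 2 * (- 1) ^ p') * (\<i> ^ (2 * p' + 1) * complex_of_real S))"
  proof -
    have "(of_rat (- 2 * (- 1) ^ p') :: complex) = - 2 * (- 1) ^ p'"
      by (simp add: of_rat_mult of_rat_power of_rat_minus)
    moreover have "\<i> ^ (2 * p' + 1) = (- 1) ^ p' * \<i>" by (simp add: power_mult)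
    moreover have "((- 1) ^ p' :: complex) * (- 1) ^ p' = 1" by (simp flip: power_mult_distrib)
    ultimately show ?thesis by (simp add: field_simps)
  qed
  ultimately show ?thesis using 1 by blast
qed

lemma inverse_central_binomial_zeta_series:
  assumes "p \<ge> 1" and "m \<ge> 1"
  shows "\<exists>S :: real.
        ((\<lambda>n. (4 ^ n / real ((2 * n) choose n)) ^ 2
              * (zeta_sum (n - 1) (replicate (p - 1) 2) * t_star_sum n (replicate k 1))
              / real n ^ (m + 2)) has_sum S) {p..}
        \<and> complex_of_real S \<in> CMZV4 (2 * p + k + m)"
proof -
  define p' m' where "p' = p - 1" and "m' = m - 1"
  have pm: "p = Suc p'" "m = Suc m'" using assms by (auto simp: p'_def m'_def)
  define h :: "nat \<Rightarrow> nat" where "h = (\<lambda>n. 2 * n)"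
  define \<mu> where "\<mu> = (\<lambda>N. 1 / central_ratio (N div 2) / (2 * real (N div 2)) * t_star_sum (N div 2) (replicate k 1))"
  have "\<exists>S. ((\<lambda>i. arcsin_coeff (2 * p) (h i) / real (h i) ^ m' * \<mu> (h i)) has_sum S) {p..} \<and>
     \<i> ^ (2 * p) * complex_of_real S \<in> CMZV4 (2 * p + m' + k + 1)"
  proof (rule arcsin_moment_has_sum)
    show "has_moment n k (\<mu> n)" if "n \<in> h ` {p..}" for n
      using that has_moment_even assms(1) by (auto simp: h_def \<mu>_def)
    show "inj_on h {p..}" by (auto simp: inj_on_def h_def)
    show "arcsin_coeff (2 * p) n = 0" if "n \<notin> h ` {p..}" for n
    proof (cases "odd n")
      case True
      then show ?thesis by (intro arcsin_coeff_parity) auto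
    next
      case False
      then obtain i where i: "n = 2 * i" by blast
      then have "i < p" using that by (force simp: h_def)
      show ?thesis
      proof (cases i)
        case 0
        then show ?thesis using i assms(1) by simp
      next
        case (Suc i')
        then show ?thesis using \<open>i < p\<close> unfolding i Suc pm arcsin_coeff_even by (simp add: zeta_sum_eq_0)
      qed
    qed
  qed (use assms in simp)
  then obtain S where S: "((\<lambda>i. arcsin_coeff (2 * p) (h i) / real (h i) ^ m' * \<mu> (h i)) has_sum S) {p..}"
    "\<i> ^ (2 * p) * complex_of_real S \<in> CMZV4 (2 * p + k + m)"
    by (auto simp: pm add_ac)
  \<comment> \<open>Here \<open>4 ^ p\<close> clears the denominator of the arcsine coefficient, and
    \<open>2 ^ m\<close> clears the twos in \<open>(2 * i) ^ (m - 1)\<close> and in the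
    \<open>2 * i\<close> below the moment.\<close>
  have "((\<lambda>i. 4 ^ p * 2 ^ m * (arcsin_coeff (2 * p) (h i) / real (h i) ^ m' * \<mu> (h i))) has_sum 4 ^ p * 2 ^ m * S) {p..}"
    by (rule has_sum_cmult_right[OF S(1)])
  also have "?this \<longleftrightarrow> ((\<lambda>n. (4 ^ n / real ((2 * n) choose n)) ^ 2
              * (zeta_sum (n - 1) (replicate (p - 1) 2) * t_star_sum n (replicate k 1))
              / real n ^ (m + 2)) has_sum 4 ^ p * 2 ^ m * S) {p..}"
  proof (rule has_sum_cong)
    fix i assume "i \<in> {p..}"
    then obtain i' where i: "i = Suc i'" using assms(1) by (cases i) auto
    define r where "r = 1 / central_ratio i"
    have r: "4 ^ i / real ((2 * i) choose i) = r" by (simp add: r_def central_ratio_def)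
    define Z T x where "Z = zeta_sum i' (replicate p' 2)" and "T = t_star_sum i (replicate k 1)" and "x = real i"
    have x: "x > 0" by (simp add: x_def i)
    have "arcsin_coeff (2 * p) (h i) = r * Z / (4 ^ p * x ^ 2)"
      unfolding h_def i pm arcsin_coeff_even r_def Z_def x_def by (simp add: add_ac)
    moreover have "\<mu> (h i) = r / (2 * x) * T"
      by (simp add: \<mu>_def h_def r_def T_def x_def)
    moreover have "4 ^ p * 2 ^ m * (r * Z / (4 ^ p * x ^ 2) / (2 * x) ^ m' * (r / (2 * x) * T)) =
        r ^ 2 * (Z * T) / x ^ (m + 2)"
      using x by (simp add: pm power_mult_distrib power2_eq_square mult_ac)
    ultimately show "4 ^ p * 2 ^ m * (arcsin_coeff (2 * p) (h i) / real (h i) ^ m' * \<mu> (h i)) =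
      (4 ^ i / real ((2 * i) choose i)) ^ 2
              * (zeta_sum (i - 1) (replicate (p - 1) 2) * t_star_sum i (replicate k 1)) / real i ^ (m + 2)"
      unfolding r Z_def T_def by (simp add: h_def i p'_def x_def)
  qed
  finally have 1: "((\<lambda>n. (4 ^ n / real ((2 * n) choose n)) ^ 2
              * (zeta_sum (n - 1) (replicate (p - 1) 2) * t_star_sum n (replicate k 1))
              / real n ^ (m + 2)) has_sum 4 ^ p * 2 ^ m * S) {p..}" .
  have "of_rat ((- 1) ^ p * 4 ^ p * 2 ^ m) * (\<i> ^ (2 * p) * complex_of_real S) \<in> CMZV4 (2 * p + k + m)"
    by (rule CMZV4_scale[OF S(2)])
  also have "of_rat ((- 1) ^ p * 4 ^ p * 2 ^ m) * (\<i> ^ (2 * p) * complex_of_real S) = complex_of_real (4 ^ p * 2 ^ m * S)"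
  proof -
    have "(of_rat ((- 1) ^ p * 4 ^ p * 2 ^ m) :: complex) = (- 1) ^ p * 4 ^ p * 2 ^ m"
      by (simp add: of_rat_mult of_rat_power of_rat_minus)
    moreover have "\<i> ^ (2 * p) = (- 1) ^ p" by (simp add: power_mult)
    moreover have "((- 1) ^ p :: complex) * (- 1) ^ p = 1" by (simp flip: power_mult_distrib)
    ultimately show ?thesis by (simp add: mult_ac)
  qed
  finally show ?thesis using 1 by blast
qed

theorem theorem9p10:
  fixes p k m :: nat
  assumes "p \<ge> 1" and "k \<ge> 1" and "m \<ge> 1"
  shows
    "(\<exists>S :: real.
        ((\<lambda>n. (1 / 4 ^ n * real ((2 * n) choose n)) ^ 2
              * t_sum n (replicate (p - 1) 2) / (2 * real n + 1) ^ m) has_sum S) {p - 1..}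
        \<and> complex_of_real S \<in> (\<lambda>x. \<i> / complex_of_real pi * x) ` CMZV4 (2 * p + m - 1))
     \<and>
     (\<exists>S :: real.
        ((\<lambda>n. (4 ^ n / real ((2 * n) choose n)) ^ 2
              * (zeta_sum (n - 1) (replicate (p - 1) 2) * t_star_sum n (replicate k 1))
              / real n ^ (m + 2)) has_sum S) {p..}
        \<and> complex_of_real S \<in> CMZV4 (2 * p + k + m))"
  using central_binomial_t_series[OF assms(1,3)] inverse_central_binomial_zeta_series[OF assms(1,3)]
  by (rule conjI)

end
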